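(* A $\mathbf{CL4}$-formula is valid if and only if it is uniformly valid.
   Context: Players and runs. Two players $\top$ (machine) and $\bot$ (environment). A move is a finite string over a fixed finite alphabet; a labmove is $\top\alpha$ or $\bot\alpha$; a run is a finite or infinite sequence of labmoves; $\langle\rangle$ is the empty run. For a run $\Gamma$ and string $\alpha$, $\Gamma^{\alpha}$ keeps only the labmoves $\wp\alpha\beta$ and replaces each by $\wp\beta$; $\overline\Gamma$ interchanges labels. Games. A constant game $A=(\mathrm{Lr}^A,\mathrm{Wn}^A)$: $\mathrm{Lr}^A$ is a set of runs (legal runs) such that a run is in it iff all its nonempty finite initial segments are; $\mathrm{Wn}^A$ maps each run to a player such that a run whose shortest illegal initial segment ends with a $\wp$-labeled move is not won by $\wp$. Variables $v_1,v_2,\dots$; constants $1,2,3,\dots$; terms are variables or constants; a valuation $e$ maps variables to constants, $e(c)=c$ for constants. A game is a function $A$ from valuations to constant games; $e[A]$ is its instance. $A$ depends on $x$ if two valuations differing only at $x$ give different instances; $A$ is unistructural in $x$ if any two valuations differing only at $x$ give instances with the same legal runs. $A(x_1/t_1,\dots,x_n/t_n)$ has $e$-instance $e'[A]$ with $e'(x_i)=e(t_i)$, $e'=e$ elsewhere. An elementary game is one whose every instance has $\langle\rangle$ as its only legal run. A run $\Delta$ is a $\wp$-delay of $\Gamma$ if both have the same subsequences of $\top$-labeled and of $\bot$-labeled moves and, for all $k,n\ge1$, whenever the $k$-th move of the other player precedes the $n$-th $\wp$-labeled move in $\Gamma$, the same holds in $\Delta$; a game is static if in each instance every $\wp$-delay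 of a run won by $\wp$ is won by $\wp$. $\top$, $\bot$ also denote the elementary constant games won by $\top$, resp. $\bot$. Operations (extended instancewise): $\neg A$: $\Gamma$ legal iff $\overline\Gamma$ legal in $A$, won by $\top$ iff $\overline\Gamma$ won by $\bot$ in $A$. $A_1\wedge\dots\wedge A_n$, $A_1\vee\dots\vee A_n$ ($n\ge2$): legal iff every move begins with "$i.$", $1\le i\le n$, and each $\Gamma^{i.}$ is legal in $A_i$; won by $\top$ iff all (for $\wedge$) / at least one (for $\vee$) $\Gamma^{i.}$ is won by $\top$ in $A_i$. $A\to B$ is $\neg A\vee B$. $A_1\sqcap\dots\sqcap A_n$: legal runs $\langle\rangle$ (won by $\top$) and $\langle\bot i,\Gamma\rangle$ with $\Gamma$ legal in $A_i$, won as $\Gamma$ in $A_i$; $\sqcup$ dually with roles interchanged. $\sqcap xA(x)$: legal runs $\langle\rangle$ (won by $\top$) and $\langle\bot c,\Gamma\rangle$, $c$ a constant, $\Gamma$ legal in $A(c)$, won as $\Gamma$ in $A(c)$; $\sqcup x$ dually. For $A(x)$ unistructural in $x$: $\forall xA(x)$ has the same legal runs as $A(x)$ (in each instance) and a legal run is won by $\top$ iff it is won by $\top$ in $A(c)$ for every constant $c$; $\exists xA(x)$ is dual (won by $\bot$ iff won by $\bot$ in every $A(c)$). EPMs. An EPM is a Turing machine with a work tape, a read-only valuation tape spelling a valuation $e$, and a read-only run tape spelling the current position; it moves $\alpha$ by writing $\alpha$ on its work tape and entering a move state ($\top\alpha$ is appended to the run tape); the environment may append one labmove $\bot\beta$ only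 while the machine is in a permission state. A computation branch is fair if permission is granted infinitely often. $\mathcal E$ wins $A$ on $e$ if for every computation branch on $e$ spelling $\Gamma$, unless $\Gamma$ is $\bot$-illegal in $e[A]$, the branch is fair and $\Gamma$ is won by $\top$ in $e[A]$; $\mathcal E$ wins $A$ if it wins on every valuation; $A$ is winnable if some EPM wins it. $\mathbf{CL4}$-formulas. For each $n\ge0$ there are infinitely many $n$-ary elementary letters and $n$-ary general letters; nonlogical atoms are $L(t_1,\dots,t_n)$ with $t_i$ terms; logical atoms $\top,\bot$. $\mathbf{CL4}$-formulas are built from atoms using $\neg$, $\to$, $\wedge,\vee,\sqcap,\sqcup$ (arity $\ge2$), and quantifiers $\forall x,\exists x,\sqcap x,\sqcup x$, with the restriction that no formula contains both bound and free occurrences of the same variable. An occurrence of a variable is blindly bound if the quantifier binding it (the nearest one on that variable) is $\forall$ or $\exists$. An interpretation $^*$ assigns to each $n$-ary elementary (resp. general) letter $L$ an elementary (resp. static) game $L^*(x_1,\dots,x_n)$ with a tuple of distinct variables (canonical tuple). It is admissible for $F$ if for every letter $L$ in $F$: (i) $L^*$ does not depend on any variable occurring in $F$ that is not in its canonical tuple; (ii) if the $i$-th term of some occurrence of an $L$-based atom in $F$ is blindly bound, then $L^*$ is unistructural in the $i$-th variable of its canonical tuple. Then $F^*$ is defined by $(L(t_1,\dots,t_n))^*=L^*(x_1/t_1,\dots,x_n/t_n)$, $\top^*=\top,\bot^*=\bot$, and $^*$ commuting with all operators. $F$ is valid if $F^*$ is winnable for every $F$-admissible $^*$; $F$ is uniformly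 valid if there is one EPM that wins $F^*$ for every $F$-admissible $^*$. *)

theory Defs
  imports Main "HOL-Library.Infinite_Set" "HOL-Library.Sublist"
begin

section \<open>Finite and infinite sequences\<close>

datatype 'a seq = Fin "'a list" | Inf "nat \<Rightarrow> 'a"

fun seq_nth :: "'a seq \<Rightarrow> nat \<Rightarrow> 'a option" where
  "seq_nth (Fin xs) i = (if i < length xs then Some (xs ! i) else None)"
| "seq_nth (Inf f) i = Some (f i)"

fun seq_take :: "nat \<Rightarrow> 'a seq \<Rightarrow> 'a list" where
  "seq_take n (Fin xs) = take n xs"
| "seq_take n (Inf f) = map f [0..<n]"

fun seq_cons :: "'a \<Rightarrow> 'a seq \<Rightarrow> 'a seq" where
  "seq_cons x (Fin xs) = Fin (x # xs)"
| "seq_cons x (Inf f) = Inf (case_nat x f)"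

text \<open>Keep the elements on which \<open>g\<close> is defined, replacing each by its value. An infinite
  sequence may become finite.\<close>

fun seq_map_filter :: "('a \<Rightarrow> 'b option) \<Rightarrow> 'a seq \<Rightarrow> 'b seq" where
  "seq_map_filter g (Fin xs) = Fin (List.map_filter g xs)"
| "seq_map_filter g (Inf f) =
     (let S = {i. g (f i) \<noteq> None} in
      if finite S then Fin (map (\<lambda>i. the (g (f i))) (sorted_list_of_set S))
      else Inf (\<lambda>n. the (g (f (enumerate S n)))))"


section \<open>Moves and runs\<close>

datatype player = Top | Bot

fun opp :: "player \<Rightarrow> player" where
  "opp Top = Bot"
| "opp Bot = Top"

text \<open>The fixed finite alphabet of moves is the type \<^typ>\<open>char\<close>.\<close>

type_synonym move = string
type_synonym labmove = "player \<times> move"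
type_synonym position = "labmove list"
type_synonym run = "labmove seq"

definition neg_run :: "run \<Rightarrow> run" where
  "neg_run = map_seq (apfst opp)"

definition subrun :: "move \<Rightarrow> run \<Rightarrow> run" where
  "subrun \<alpha> = seq_map_filter
     (\<lambda>(p, m). if prefix \<alpha> m then Some (p, drop (length \<alpha>) m) else None)"

definition moves_of :: "player \<Rightarrow> run \<Rightarrow> run" where
  "moves_of p = seq_map_filter (\<lambda>lm. if fst lm = p then Some lm else None)"

definition has_label_at :: "run \<Rightarrow> player \<Rightarrow> nat \<Rightarrow> bool" where
  "has_label_at \<Gamma> p i \<longleftrightarrow> (\<exists>m. seq_nth \<Gamma> i = Some (p, m))"

text \<open>\<open>kth_at \<Gamma> p k i\<close>: the \<open>k\<close>-th \<open>p\<close>-labeled move of \<open>\<Gamma>\<close> exists and is at index \<open>i\<close>. Here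
  \<open>k\<close> counts from 1 and \<open>i\<close> from 0; in particular \<open>k \<ge> 1\<close>.\<close>

definition kth_at :: "run \<Rightarrow> player \<Rightarrow> nat \<Rightarrow> nat \<Rightarrow> bool" where
  "kth_at \<Gamma> p k i \<longleftrightarrow> has_label_at \<Gamma> p i \<and> card {j. j \<le> i \<and> has_label_at \<Gamma> p j} = k"

text \<open>The \<open>k\<close>-th \<open>p\<close>-labeled move precedes the \<open>n\<close>-th \<open>q\<close>-labeled move.\<close>

definition precedes :: "run \<Rightarrow> player \<Rightarrow> nat \<Rightarrow> player \<Rightarrow> nat \<Rightarrow> bool" where
  "precedes \<Gamma> p k q n \<longleftrightarrow> (\<exists>i j. kth_at \<Gamma> p k i \<and> kth_at \<Gamma> q n j \<and> i < j)"

definition delay :: "player \<Rightarrow> run \<Rightarrow> run \<Rightarrow> bool" where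
  "delay p \<Delta> \<Gamma> \<longleftrightarrow>
     moves_of Top \<Delta> = moves_of Top \<Gamma> \<and> moves_of Bot \<Delta> = moves_of Bot \<Gamma> \<and>
     (\<forall>k\<ge>1. \<forall>n\<ge>1. precedes \<Gamma> (opp p) k p n \<longrightarrow> precedes \<Delta> (opp p) k p n)"


section \<open>Constants, variables, terms, valuations\<close>

typedef cst = "{n::nat. 1 \<le> n}"
  morphisms nat_of_cst cst_of_nat
  by (rule exI[of _ 1]) simp

text \<open>The number \<open>n\<close> encodes the variable \<open>v\<close> with index \<open>n + 1\<close>.\<close>

type_synonym var = nat

datatype trm = TVar var | TConst cst

type_synonym valuation = "var \<Rightarrow> cst"

fun trm_val :: "valuation \<Rightarrow> trm \<Rightarrow> cst" where
  "trm_val e (TVar x) = e x"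
| "trm_val e (TConst c) = c"

text \<open>Decimal notation without leading zeros; 48 is the character code of the digit 0.\<close>

fun decimal :: "nat \<Rightarrow> string" where
  "decimal n = (if n < 10 then [char_of (48 + n)]
                else decimal (n div 10) @ [char_of (48 + n mod 10)])"

declare decimal.simps [simp del]

definition const_name :: "cst \<Rightarrow> string" where
  "const_name c = decimal (nat_of_cst c)"


section \<open>Games\<close>

record cgame =
  Lr :: "run set"
  Wn :: "run \<Rightarrow> player"

text \<open>With \<open>L\<close> the set of legal runs: the shortest illegal initial segment of the run exists and its
  last move is \<open>p\<close>-labeled.\<close>

definition illegal_by :: "run set \<Rightarrow> player \<Rightarrow> run \<Rightarrow> bool" where
  "illegal_by L p \<Gamma> \<longleftrightarrow>
     (\<exists>n. seq_take n \<Gamma> \<noteq> [] \<and> Fin (seq_take n \<Gamma>) \<notin> L \<and>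
          (\<forall>k<n. Fin (seq_take k \<Gamma>) \<in> L) \<and> fst (last (seq_take n \<Gamma>)) = p)"

definition constant_game :: "cgame \<Rightarrow> bool" where
  "constant_game A \<longleftrightarrow>
     (\<forall>\<Gamma>. \<Gamma> \<in> Lr A \<longleftrightarrow> (\<forall>n. seq_take n \<Gamma> \<noteq> [] \<longrightarrow> Fin (seq_take n \<Gamma>) \<in> Lr A)) \<and>
     (\<forall>p \<Gamma>. illegal_by (Lr A) p \<Gamma> \<longrightarrow> Wn A \<Gamma> \<noteq> p)"

text \<open>A constant game given by its legal runs and the winners of those; an illegal run is lost by
  the player who made the first illegal move.\<close>

definition mk_game :: "run set \<Rightarrow> (run \<Rightarrow> player) \<Rightarrow> cgame" where
  "mk_game L w = \<lparr>Lr = L,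
     Wn = (\<lambda>\<Gamma>. if \<Gamma> \<in> L then w \<Gamma> else if illegal_by L Top \<Gamma> then Bot else Top)\<rparr>"

type_synonym game = "valuation \<Rightarrow> cgame"

definition is_game :: "game \<Rightarrow> bool" where
  "is_game A \<longleftrightarrow> (\<forall>e. constant_game (A e))"

definition differ_only_at :: "var \<Rightarrow> valuation \<Rightarrow> valuation \<Rightarrow> bool" where
  "differ_only_at x e e' \<longleftrightarrow> (\<forall>y. y \<noteq> x \<longrightarrow> e y = e' y)"

definition depends_on :: "game \<Rightarrow> var \<Rightarrow> bool" where
  "depends_on A x \<longleftrightarrow> (\<exists>e e'. differ_only_at x e e' \<and> A e \<noteq> A e')"

definition unistructural_in :: "game \<Rightarrow> var \<Rightarrow> bool" where
  "unistructural_in A x \<longleftrightarrow> (\<forall>e e'. differ_only_at x e e' \<longrightarrow> Lr (A e) = Lr (A e'))"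

definition elementary :: "game \<Rightarrow> bool" where
  "elementary A \<longleftrightarrow> (\<forall>e. Lr (A e) = {Fin []})"

definition static :: "game \<Rightarrow> bool" where
  "static A \<longleftrightarrow>
     (\<forall>e p \<Gamma> \<Delta>. delay p \<Delta> \<Gamma> \<longrightarrow> Wn (A e) \<Gamma> = p \<longrightarrow> Wn (A e) \<Delta> = p)"

definition subst_game :: "var list \<Rightarrow> trm list \<Rightarrow> game \<Rightarrow> game" where
  "subst_game xs ts A e =
     A (\<lambda>x. case map_of (zip xs (map (trm_val e) ts)) x of Some c \<Rightarrow> c | None \<Rightarrow> e x)"


section \<open>Game operations\<close>

text \<open>The operations come in dual pairs, written here with a player parameter \<open>p\<close>. For the parallel
  and blind operations, \<open>p\<close> is the player for whom winning one component suffices; for the choice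
  operations, \<open>p\<close> is the player who chooses. So \<open>p = Top\<close> gives the disjunction or existential
  quantifier, and \<open>p = Bot\<close> the conjunction or universal quantifier.\<close>

definition trivial_game :: "player \<Rightarrow> cgame" where
  "trivial_game p = mk_game {Fin []} (\<lambda>_. p)"

definition neg_game :: "cgame \<Rightarrow> cgame" where
  "neg_game A = \<lparr>Lr = {\<Gamma>. neg_run \<Gamma> \<in> Lr A}, Wn = (\<lambda>\<Gamma>. opp (Wn A (neg_run \<Gamma>)))\<rparr>"

definition comp_prefix :: "nat \<Rightarrow> move" where
  "comp_prefix i = decimal i @ ''.''"

text \<open>Components are numbered from 1, lists from 0.\<close>

definition parallel :: "player \<Rightarrow> cgame list \<Rightarrow> cgame" where
  "parallel p As = mk_game
     {\<Gamma>. (\<forall>lm \<in> set_seq \<Gamma>. \<exists>i\<in>{1..length As}. prefix (comp_prefix i) (snd lm)) \<and>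
          (\<forall>i\<in>{1..length As}. subrun (comp_prefix i) \<Gamma> \<in> Lr (As ! (i - 1)))}
     (\<lambda>\<Gamma>. if \<exists>i\<in>{1..length As}. Wn (As ! (i - 1)) (subrun (comp_prefix i) \<Gamma>) = p
           then p else opp p)"

text \<open>A choice among the games \<open>A i\<close> with \<open>i \<in> I\<close>, where selecting \<open>i\<close> is the move \<open>name i\<close>.\<close>

definition choice :: "player \<Rightarrow> ('i \<Rightarrow> move) \<Rightarrow> 'i set \<Rightarrow> ('i \<Rightarrow> cgame) \<Rightarrow> cgame" where
  "choice p name I A = mk_game
     ({Fin []} \<union> {seq_cons (p, name i) \<Gamma> | i \<Gamma>. i \<in> I \<and> \<Gamma> \<in> Lr (A i)})
     (\<lambda>\<Delta>. if \<exists>i\<in>I. \<exists>\<Gamma>. \<Delta> = seq_cons (p, name i) \<Gamma> \<and> Wn (A i) \<Gamma> = p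
           then p else opp p)"

definition choice_list :: "player \<Rightarrow> cgame list \<Rightarrow> cgame" where
  "choice_list p As = choice p decimal {1..length As} (\<lambda>i. As ! (i - 1))"

definition choice_quant :: "player \<Rightarrow> var \<Rightarrow> game \<Rightarrow> game" where
  "choice_quant p x A e = choice p const_name UNIV (\<lambda>c. A (e(x := c)))"

text \<open>Meaningful when \<open>A\<close> is unistructural in \<open>x\<close>.\<close>

definition blind_quant :: "player \<Rightarrow> var \<Rightarrow> game \<Rightarrow> game" where
  "blind_quant p x A e = mk_game (Lr (A e))
     (\<lambda>\<Gamma>. if \<exists>c. Wn (A (e(x := c))) \<Gamma> = p then p else opp p)"


section \<open>EPMs\<close>

text \<open>Work-tape symbols: the blank, the move alphabet, and auxiliary symbols, of which each machine
  uses only finitely many.\<close>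

datatype wsym = Blank | Chr char | Aux nat

datatype rsym = REnd | RLab player | RChr char

datatype dir = Lft | Stay | Rgt

text \<open>All tapes are infinite to the right only; moving left from the first cell has no effect.\<close>

fun move_head :: "dir \<Rightarrow> nat \<Rightarrow> nat" where
  "move_head Lft h = h - 1"
| "move_head Stay h = h"
| "move_head Rgt h = Suc h"

text \<open>The transition function takes the state and the symbols scanned on the work, valuation and run
  tapes to the next state, the symbol written on the work tape, and the directions of the three heads
  in that order.\<close>

record epm =
  states :: "nat set"
  work_symbols :: "wsym set"
  start_state :: nat
  move_states :: "nat set"
  permission_states :: "nat set"
  delta :: "nat \<Rightarrow> wsym \<Rightarrow> char \<Rightarrow> rsym \<Rightarrow> nat \<times> wsym \<times> dir \<times> dir \<times> dir"

definition is_epm :: "epm \<Rightarrow> bool" where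
  "is_epm E \<longleftrightarrow>
     finite (states E) \<and> finite (work_symbols E) \<and>
     insert Blank (range Chr) \<subseteq> work_symbols E \<and>
     start_state E \<in> states E \<and>
     move_states E \<subseteq> states E \<and> permission_states E \<subseteq> states E \<and>
     move_states E \<inter> permission_states E = {} \<and>
     (\<forall>q\<in>states E. \<forall>a\<in>work_symbols E. \<forall>b c. \<forall>q' a' ds.
        delta E q a b c = (q', a', ds) \<longrightarrow> q' \<in> states E \<and> a' \<in> work_symbols E)"

text \<open>The valuation tape lists the values of the variables, each followed by a comma. Every entry
  occupies a cell, so the first \<open>Suc k\<close> entries cover cell \<open>k\<close>.\<close>

definition valuation_tape :: "valuation \<Rightarrow> nat \<Rightarrow> char" where
  "valuation_tape e k = concat (map (\<lambda>i. const_name (e i) @ '','') [0..<Suc k]) ! k"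

definition run_tape :: "position \<Rightarrow> nat \<Rightarrow> rsym" where
  "run_tape \<Phi> k =
     (let s = concat (map (\<lambda>(p, m). RLab p # map RChr m) \<Phi>)
      in if k < length s then s ! k else REnd)"

text \<open>The move spelled by the work tape: its longest initial part consisting of symbols of the move
  alphabet. In computations only finitely many cells are nonblank, so the minimum exists.\<close>

definition work_move :: "(nat \<Rightarrow> wsym) \<Rightarrow> move" where
  "work_move t =
     map (\<lambda>i. case t i of Chr a \<Rightarrow> a) [0..<(LEAST n. t n \<notin> range Chr)]"

record config =
  state :: nat
  work :: "nat \<Rightarrow> wsym"
  work_head :: nat
  val_head :: nat
  run_head :: nat
  pos :: position

definition init_config :: "epm \<Rightarrow> config" where
  "init_config E = \<lparr>state = start_state E, work = (\<lambda>_. Blank),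
     work_head = 0, val_head = 0, run_head = 0, pos = []\<rparr>"

text \<open>\<open>ms\<close> is what the environment does during the step: nothing, or one move if the machine is in a
  permission state. The machine moves by entering a move state.\<close>

definition step :: "epm \<Rightarrow> valuation \<Rightarrow> config \<Rightarrow> config \<Rightarrow> bool" where
  "step E e C C' \<longleftrightarrow>
     (\<exists>ms. (ms = [] \<or> state C \<in> permission_states E \<and> (\<exists>\<beta>. ms = [(Bot, \<beta>)])) \<and>
       (\<exists>q a dw dv dr t.
          delta E (state C) (work C (work_head C)) (valuation_tape e (val_head C))
            (run_tape (pos C) (run_head C)) = (q, a, dw, dv, dr) \<and>
          t = (work C)(work_head C := a) \<and>
          C' = \<lparr>state = q, work = t,
                work_head = move_head dw (work_head C),
                val_head = move_head dv (val_head C),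
                run_head = move_head dr (run_head C),
                pos = pos C @ ms @ (if q \<in> move_states E then [(Top, work_move t)] else [])\<rparr>))"

definition branch :: "epm \<Rightarrow> valuation \<Rightarrow> (nat \<Rightarrow> config) \<Rightarrow> bool" where
  "branch E e B \<longleftrightarrow> B 0 = init_config E \<and> (\<forall>n. step E e (B n) (B (Suc n)))"

text \<open>The positions on the run tape are initial segments of \<open>\<Gamma>\<close> and exhaust it.\<close>

definition spells :: "(nat \<Rightarrow> config) \<Rightarrow> run \<Rightarrow> bool" where
  "spells B \<Gamma> \<longleftrightarrow> (\<forall>n. \<exists>k. pos (B n) = seq_take k \<Gamma>) \<and>
                  (\<forall>k. \<exists>n. prefix (seq_take k \<Gamma>) (pos (B n)))"

definition fair :: "epm \<Rightarrow> (nat \<Rightarrow> config) \<Rightarrow> bool" where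
  "fair E B \<longleftrightarrow> infinite {n. state (B n) \<in> permission_states E}"

definition wins_on :: "epm \<Rightarrow> game \<Rightarrow> valuation \<Rightarrow> bool" where
  "wins_on E A e \<longleftrightarrow>
     (\<forall>B \<Gamma>. branch E e B \<longrightarrow> spells B \<Gamma> \<longrightarrow> \<not> illegal_by (Lr (A e)) Bot \<Gamma> \<longrightarrow>
        fair E B \<and> Wn (A e) \<Gamma> = Top)"

definition wins :: "epm \<Rightarrow> game \<Rightarrow> bool" where
  "wins E A \<longleftrightarrow> (\<forall>e. wins_on E A e)"

definition winnable :: "game \<Rightarrow> bool" where
  "winnable A \<longleftrightarrow> (\<exists>E. is_epm E \<and> wins E A)"


section \<open>Formulas\<close>

text \<open>\<open>Elem n k\<close> and \<open>Gen n k\<close> are the \<open>k\<close>-th \<open>n\<close>-ary elementary and general letters.\<close>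

datatype letter = Elem nat nat | Gen nat nat

fun arity :: "letter \<Rightarrow> nat" where
  "arity (Elem n k) = n"
| "arity (Gen n k) = n"

text \<open>The prefixes \<open>P\<close>, \<open>C\<close>, \<open>B\<close> stand for parallel, choice and blind.\<close>

datatype formula =
    FTop
  | FBot
  | Atom letter "trm list"
  | Neg formula
  | Imp formula formula
  | PAnd "formula list"
  | POr "formula list"
  | CAnd "formula list"
  | COr "formula list"
  | BAll var formula
  | BEx var formula
  | CAll var formula
  | CEx var formula

fun well_formed :: "formula \<Rightarrow> bool" where
  "well_formed FTop = True"
| "well_formed FBot = True"
| "well_formed (Atom L ts) = (length ts = arity L)"
| "well_formed (Neg F) = well_formed F"
| "well_formed (Imp F G) = (well_formed F \<and> well_formed G)"
| "well_formed (PAnd Fs) = (2 \<le> length Fs \<and> (\<forall>F\<in>set Fs. well_formed F))"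
| "well_formed (POr Fs) = (2 \<le> length Fs \<and> (\<forall>F\<in>set Fs. well_formed F))"
| "well_formed (CAnd Fs) = (2 \<le> length Fs \<and> (\<forall>F\<in>set Fs. well_formed F))"
| "well_formed (COr Fs) = (2 \<le> length Fs \<and> (\<forall>F\<in>set Fs. well_formed F))"
| "well_formed (BAll x F) = well_formed F"
| "well_formed (BEx x F) = well_formed F"
| "well_formed (CAll x F) = well_formed F"
| "well_formed (CEx x F) = well_formed F"

fun free_vars :: "formula \<Rightarrow> var set" where
  "free_vars FTop = {}"
| "free_vars FBot = {}"
| "free_vars (Atom L ts) = {x. TVar x \<in> set ts}"
| "free_vars (Neg F) = free_vars F"
| "free_vars (Imp F G) = free_vars F \<union> free_vars G"
| "free_vars (PAnd Fs) = (\<Union>F\<in>set Fs. free_vars F)"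
| "free_vars (POr Fs) = (\<Union>F\<in>set Fs. free_vars F)"
| "free_vars (CAnd Fs) = (\<Union>F\<in>set Fs. free_vars F)"
| "free_vars (COr Fs) = (\<Union>F\<in>set Fs. free_vars F)"
| "free_vars (BAll x F) = free_vars F - {x}"
| "free_vars (BEx x F) = free_vars F - {x}"
| "free_vars (CAll x F) = free_vars F - {x}"
| "free_vars (CEx x F) = free_vars F - {x}"

text \<open>As usual, the occurrence of a variable in a quantifier prefix counts as bound.\<close>

fun bound_vars :: "formula \<Rightarrow> var set" where
  "bound_vars FTop = {}"
| "bound_vars FBot = {}"
| "bound_vars (Atom L ts) = {}"
| "bound_vars (Neg F) = bound_vars F"
| "bound_vars (Imp F G) = bound_vars F \<union> bound_vars G"
| "bound_vars (PAnd Fs) = (\<Union>F\<in>set Fs. bound_vars F)"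
| "bound_vars (POr Fs) = (\<Union>F\<in>set Fs. bound_vars F)"
| "bound_vars (CAnd Fs) = (\<Union>F\<in>set Fs. bound_vars F)"
| "bound_vars (COr Fs) = (\<Union>F\<in>set Fs. bound_vars F)"
| "bound_vars (BAll x F) = insert x (bound_vars F)"
| "bound_vars (BEx x F) = insert x (bound_vars F)"
| "bound_vars (CAll x F) = insert x (bound_vars F)"
| "bound_vars (CEx x F) = insert x (bound_vars F)"

definition vars_of :: "formula \<Rightarrow> var set" where
  "vars_of F = free_vars F \<union> bound_vars F"

definition cl4_formula :: "formula \<Rightarrow> bool" where
  "cl4_formula F \<longleftrightarrow> well_formed F \<and> free_vars F \<inter> bound_vars F = {}"

fun letters_of :: "formula \<Rightarrow> letter set" where
  "letters_of FTop = {}"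
| "letters_of FBot = {}"
| "letters_of (Atom L ts) = {L}"
| "letters_of (Neg F) = letters_of F"
| "letters_of (Imp F G) = letters_of F \<union> letters_of G"
| "letters_of (PAnd Fs) = (\<Union>F\<in>set Fs. letters_of F)"
| "letters_of (POr Fs) = (\<Union>F\<in>set Fs. letters_of F)"
| "letters_of (CAnd Fs) = (\<Union>F\<in>set Fs. letters_of F)"
| "letters_of (COr Fs) = (\<Union>F\<in>set Fs. letters_of F)"
| "letters_of (BAll x F) = letters_of F"
| "letters_of (BEx x F) = letters_of F"
| "letters_of (CAll x F) = letters_of F"
| "letters_of (CEx x F) = letters_of F"

text \<open>The pairs \<open>(L, i)\<close> such that in some occurrence of an \<open>L\<close>-based atom the argument with index
  \<open>i\<close> (from 0) is blindly bound, given that the variables in \<open>X\<close> are blindly bound by the context.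
  A choice quantifier on \<open>x\<close> takes \<open>x\<close> over from any outer blind one.\<close>

fun blind_args :: "var set \<Rightarrow> formula \<Rightarrow> (letter \<times> nat) set" where
  "blind_args X FTop = {}"
| "blind_args X FBot = {}"
| "blind_args X (Atom L ts) = {(L, i) | i. i < length ts \<and> (\<exists>x\<in>X. ts ! i = TVar x)}"
| "blind_args X (Neg F) = blind_args X F"
| "blind_args X (Imp F G) = blind_args X F \<union> blind_args X G"
| "blind_args X (PAnd Fs) = (\<Union>F\<in>set Fs. blind_args X F)"
| "blind_args X (POr Fs) = (\<Union>F\<in>set Fs. blind_args X F)"
| "blind_args X (CAnd Fs) = (\<Union>F\<in>set Fs. blind_args X F)"
| "blind_args X (COr Fs) = (\<Union>F\<in>set Fs. blind_args X F)"
| "blind_args X (BAll x F) = blind_args (insert x X) F"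
| "blind_args X (BEx x F) = blind_args (insert x X) F"
| "blind_args X (CAll x F) = blind_args (X - {x}) F"
| "blind_args X (CEx x F) = blind_args (X - {x}) F"


section \<open>Interpretations and validity\<close>

text \<open>Each letter is assigned its canonical tuple and a game.\<close>

type_synonym interp = "letter \<Rightarrow> var list \<times> game"

definition interpretation_of_letters :: "interp \<Rightarrow> bool" where
  "interpretation_of_letters I \<longleftrightarrow>
     (\<forall>L. length (fst (I L)) = arity L \<and> distinct (fst (I L)) \<and> is_game (snd (I L))) \<and>
     (\<forall>n k. elementary (snd (I (Elem n k)))) \<and>
     (\<forall>n k. static (snd (I (Gen n k))))"

definition admissible :: "formula \<Rightarrow> interp \<Rightarrow> bool" where
  "admissible F I \<longleftrightarrow>
     (\<forall>L\<in>letters_of F. \<forall>x\<in>vars_of F.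
        x \<notin> set (fst (I L)) \<longrightarrow> \<not> depends_on (snd (I L)) x) \<and>
     (\<forall>(L, i)\<in>blind_args {} F. unistructural_in (snd (I L)) (fst (I L) ! i))"

fun game_of :: "interp \<Rightarrow> formula \<Rightarrow> game" where
  "game_of I FTop = (\<lambda>e. trivial_game Top)"
| "game_of I FBot = (\<lambda>e. trivial_game Bot)"
| "game_of I (Atom L ts) = subst_game (fst (I L)) ts (snd (I L))"
| "game_of I (Neg F) = (\<lambda>e. neg_game (game_of I F e))"
| "game_of I (Imp F G) =
     (\<lambda>e. parallel Top [neg_game (game_of I F e), game_of I G e])"
| "game_of I (PAnd Fs) = (\<lambda>e. parallel Bot (map (\<lambda>F. game_of I F e) Fs))"
| "game_of I (POr Fs) = (\<lambda>e. parallel Top (map (\<lambda>F. game_of I F e) Fs))"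
| "game_of I (CAnd Fs) = (\<lambda>e. choice_list Bot (map (\<lambda>F. game_of I F e) Fs))"
| "game_of I (COr Fs) = (\<lambda>e. choice_list Top (map (\<lambda>F. game_of I F e) Fs))"
| "game_of I (BAll x F) = blind_quant Bot x (game_of I F)"
| "game_of I (BEx x F) = blind_quant Top x (game_of I F)"
| "game_of I (CAll x F) = choice_quant Bot x (game_of I F)"
| "game_of I (CEx x F) = choice_quant Top x (game_of I F)"

definition valid :: "formula \<Rightarrow> bool" where
  "valid F \<longleftrightarrow>
     (\<forall>I. interpretation_of_letters I \<longrightarrow> admissible F I \<longrightarrow> winnable (game_of I F))"

definition uniformly_valid :: "formula \<Rightarrow> bool" where
  "uniformly_valid F \<longleftrightarrow>
     (\<exists>E. is_epm E \<and>
        (\<forall>I. interpretation_of_letters I \<longrightarrow> admissible F I \<longrightarrow> wins E (game_of I F)))"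

end

(*
  No syntax or proof theory of CL4 is needed: the argument is a diagonalisation over all EPMs,
  using variables that do not occur in F.

  Suppose that no EPM wins F uniformly. EPMs have only countably many behaviours, represented by
  E_0, E_1, ...  Fix variables z_0, z_1, ... not occurring in F, and let phi_i replace every digit of
  the values of z_0, ..., z_(i-1) by 1 and every digit of the value of z_i by 2. Some EPM E_i' behaves
  at e as E_i does at phi_i(e). It does not win uniformly, so it fails under some interpretation I_i at
  some valuation e_i. The index i can be recovered from phi_i(e_i), and only through variables on which
  an interpretation of the letters of F is free to depend. So the I_i merge into one interpretation I,
  under which F at phi_i(e_i) is the same game as F under I_i at e_i, and which therefore defeats
  every E_i.

  Recolouring keeps the length of every entry, so E_i' only has to know which entry its valuation head
  is reading. Up to the last recoloured entry its finite control keeps track of that; beyond it, the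
  distance is counted in unary on the work tape, to the right of everything that E_i has used.
*)

theory Submission
  imports Defs "HOL-Library.Countable_Set"
begin

section \<open>Recolouring valuation tapes\<close>

text \<open>The index, from 0, of the entry to which cell \<open>v\<close> belongs; the comma that
  closes an entry is part of it.\<close>

primrec seg :: "(nat \<Rightarrow> char) \<Rightarrow> nat \<Rightarrow> nat" where
  "seg tp 0 = 0"
| "seg tp (Suc v) = seg tp v + (if tp v = CHR '','' then 1 else 0)"

definition paint :: "(var \<Rightarrow> char option) \<Rightarrow> nat \<Rightarrow> char \<Rightarrow> char" where
  "paint D s b = (if b = CHR '','' then b else case D s of None \<Rightarrow> b | Some d \<Rightarrow> d)"

text \<open>Meaningful for \<open>n > 0\<close> and \<open>d\<close> a digit other than 0.\<close>

definition repdigit :: "nat \<Rightarrow> char \<Rightarrow> cst" where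
  "repdigit n d = (SOME c. const_name c = replicate n d)"

definition recolour :: "(var \<Rightarrow> char option) \<Rightarrow> valuation \<Rightarrow> valuation" where
  "recolour D e x =
     (case D x of None \<Rightarrow> e x | Some d \<Rightarrow> repdigit (length (const_name (e x))) d)"

section \<open>Decimal names and repeated digits\<close>

lemma decimal_nonempty: "decimal n \<noteq> []"
  by (subst decimal.simps) simp

lemma decimal_no_comma: "CHR '','' \<notin> set (decimal n)"
proof (induction n rule: decimal.induct)
  case (1 n)
  have *: "CHR '','' \<noteq> char_of (48 + k)" if "k < 10" for k :: nat
  proof
    assume "CHR '','' = char_of (48 + k)"
    then have "of_char (CHR '','') = (of_char (char_of (48 + k) :: char) :: nat)" by simp
    then show False using that by (simp add: of_char_of)
  qed
  show ?case
    using 1 *[of n] *[of "n mod 10"] by (subst decimal.simps) auto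
qed

text \<open>Appending the digit \<open>d\<close> sends \<open>m\<close> to
  \<open>10 * m + d\<close>. As \<open>m\<close> is positive, this number is at least 10 and the
  recursive clause of \<open>decimal\<close> applies.\<close>

lemma ex_repdigit:
  fixes d n :: nat
  assumes "1 \<le> d" "d < 10" "0 < n"
  shows "\<exists>m\<ge>1. decimal m = replicate n (char_of (48 + d))"
  using assms(3)
proof (induction n rule: nat_induct_non_zero)
  case 1
  then show ?case using assms by (intro exI[of _ d]) (subst decimal.simps, simp)
next
  case (Suc n)
  then obtain m where m: "m \<ge> 1" "decimal m = replicate n (char_of (48 + d))" by blast
  have "decimal (10 * m + d) = decimal m @ [char_of (48 + d)]"
    using m assms by (subst decimal.simps) simp
  then show ?case
    using m by (intro exI[of _ "10 * m + d"]) (simp add: replicate_append_same)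
qed

lemma const_name_repdigit:
  assumes "d \<in> {CHR ''1'', CHR ''2''}" "0 < n"
  shows "const_name (repdigit n d) = replicate n d"
proof -
  have d: "CHR ''1'' = char_of (48 + 1 :: nat)" "CHR ''2'' = char_of (48 + 2 :: nat)"
    using char_of_char[of "CHR ''1''", where 'a = nat] char_of_char[of "CHR ''2''", where 'a = nat] by simp_all
  obtain m where "m \<ge> 1" "decimal m = replicate n d"
    using assms ex_repdigit[of 1 n] ex_repdigit[of 2 n] unfolding d by auto
  then have "const_name (cst_of_nat m) = replicate n d"
    by (simp add: const_name_def cst_of_nat_inverse)
  then show ?thesis unfolding repdigit_def by (rule someI)
qed

section \<open>Valuation tapes as concatenated entries\<close>

definition entries :: "valuation \<Rightarrow> nat \<Rightarrow> string" where
  "entries e n = concat (map (\<lambda>i. const_name (e i) @ '','') [0..<n])"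

lemma entries_Suc: "entries e (Suc n) = entries e n @ const_name (e n) @ '',''"
  by (simp add: entries_def)

lemma entries_0 [simp]: "entries e 0 = []"
  by (simp add: entries_def)

lemma const_name_nonempty: "const_name c \<noteq> []"
  by (simp add: const_name_def decimal_nonempty)

lemma const_name_no_comma: "CHR '','' \<notin> set (const_name c)"
  by (simp add: const_name_def decimal_no_comma)

lemma length_entries: "n \<le> length (entries e n)"
  by (induction n) (auto simp: entries_Suc)

lemma entries_add: "\<exists>s. entries e (n + k) = entries e n @ s"
  by (induction k) (auto simp: entries_Suc)

text \<open>\<open>valuation_tape\<close> reads cell \<open>k\<close> off exactly
  \<open>Suc k\<close> entries. Any number \<open>n\<close> of entries that covers the cell will do,
  since both strings are initial parts of the first \<open>n + Suc k\<close> entries.\<close>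

lemma valuation_tape_entries:
  assumes "k < length (entries e n)"
  shows "valuation_tape e k = entries e n ! k"
proof -
  have k: "k < length (entries e (Suc k))" using length_entries[of "Suc k" e] by simp
  have "entries e (Suc k) ! k = entries e (n + Suc k) ! k"
    using entries_add[of e "Suc k" n] k by (auto simp: nth_append add.commute)
  also have "\<dots> = entries e n ! k"
    using entries_add[of e n "Suc k"] assms by (auto simp: nth_append)
  finally show ?thesis by (simp add: valuation_tape_def entries_def)
qed

lemma commas_entries: "length (filter ((=) CHR '','') (entries e n)) = n"
proof -
  have "filter ((=) CHR '','') (const_name c) = []" for c
    using const_name_no_comma by (auto simp: filter_empty_conv)
  then show ?thesis by (induction n) (auto simp: entries_Suc)
qed

lemma seg_eq:
  assumes "v \<le> length (entries e n)"
  shows "seg (valuation_tape e) v = length (filter ((=) CHR '','') (take v (entries e n)))"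
  using assms
  by (induction v) (auto simp: take_Suc_conv_app_nth valuation_tape_entries[of _ e n])

text \<open>Recolouring preserves the length of each entry, so cells and commas of the two tapes
  stay aligned. In the induction a cell lies in an earlier entry, among the digits of entry
  \<open>n\<close>, or on its closing comma.\<close>

lemma recolour_entries:
  assumes D: "ran D \<subseteq> {CHR ''1'', CHR ''2''}"
  shows "length (entries (recolour D e) n) = length (entries e n) \<and>
    (\<forall>v < length (entries e n). entries (recolour D e) n ! v =
      paint D (length (filter ((=) CHR '','') (take v (entries e n)))) (entries e n ! v))"
proof (induction n)
  case (Suc n)
  let ?w = "const_name (e n)" and ?w' = "const_name (recolour D e n)"
  have w': "?w' = map (\<lambda>b. case D n of None \<Rightarrow> b | Some d \<Rightarrow> d) ?w"
  proof (cases "D n")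
    case (Some d)
    then have "d \<in> {CHR ''1'', CHR ''2''}" using D by (auto simp: ran_def)
    then show ?thesis
      using Some const_name_nonempty by (simp add: recolour_def const_name_repdigit map_replicate_const)
  qed (simp add: recolour_def)
  have no: "filter ((=) CHR '','') (take k ?w) = []" for k
    using const_name_no_comma set_take_subset by (fastforce simp: filter_empty_conv)
  show ?case
  proof (intro conjI allI impI)
    show "length (entries (recolour D e) (Suc n)) = length (entries e (Suc n))"
      using Suc by (simp add: entries_Suc w')
    fix v
    assume v: "v < length (entries e (Suc n))"
    then have "v < length (entries e n) \<or> length (entries e n) \<le> v \<and> v - length (entries e n) < length ?w
        \<or> v = length (entries e n) + length ?w"
      by (simp add: entries_Suc) arith
    then consider "v < length (entries e n)" | k where "v = length (entries e n) + k" "k < length ?w"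
      | "v = length (entries e n) + length ?w"
      by (metis le_add_diff_inverse)
    then show "entries (recolour D e) (Suc n) ! v = paint D
        (length (filter ((=) CHR '','') (take v (entries e (Suc n))))) (entries e (Suc n) ! v)"
    proof cases
      case 1
      then show ?thesis using Suc by (simp add: entries_Suc nth_append)
    next
      case 2
      have "?w ! k \<noteq> CHR '',''" using 2 const_name_no_comma nth_mem by metis
      then show ?thesis
        using Suc 2 no by (simp add: entries_Suc nth_append w' commas_entries paint_def split: option.split)
    next
      case 3
      then show ?thesis
        using Suc by (simp add: entries_Suc nth_append w' paint_def)
    qed
  qed
qed simp

text \<open>This makes recolouring computable on the fly: the new symbol depends only on the scanned
  symbol and on the index of its entry.\<close>

lemma valuation_tape_recolour:
  assumes "ran D \<subseteq> {CHR ''1'', CHR ''2''}"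
  shows "valuation_tape (recolour D e) v = paint D (seg (valuation_tape e) v) (valuation_tape e v)"
proof -
  have "v < length (entries e (Suc v))" using length_entries[of "Suc v" e] by simp
  then show ?thesis
    using recolour_entries[OF assms, of e "Suc v"]
    by (simp add: valuation_tape_entries[of _ _ "Suc v"] seg_eq[of _ _ "Suc v"])
qed

lemma valuation_tape_0: "valuation_tape e 0 \<noteq> CHR '',''"
proof -
  have "valuation_tape e 0 = const_name (e 0) ! 0"
    using const_name_nonempty by (simp add: valuation_tape_def nth_append)
  then show ?thesis
    using const_name_nonempty const_name_no_comma nth_mem by (metis length_greater_0_conv)
qed

section \<open>Countability of EPMs\<close>

instance char :: countable
  by (rule countable_classI[of "of_char :: char \<Rightarrow> nat"]) simp

instance wsym :: countable
  by countable_datatype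

instance player :: countable
  by countable_datatype

instance rsym :: countable
  by countable_datatype

instance dir :: countable
  by countable_datatype

type_synonym machine_code =
  "nat set \<times> wsym set \<times> nat \<times> nat set \<times> nat set \<times>
   ((nat \<times> wsym \<times> char \<times> rsym) \<times> nat \<times> wsym \<times> dir \<times> dir \<times> dir) set"

text \<open>Since \<open>delta\<close> is a total function, the type \<open>epm\<close> is
  uncountable. Cut down to the declared states and symbols, its graph is finite, and computations
  see nothing else.\<close>

definition code :: "epm \<Rightarrow> machine_code" where
  "code E = (states E, work_symbols E, start_state E, move_states E, permission_states E,
     (\<lambda>(q, a, b, r). ((q, a, b, r), delta E q a b r)) ` (states E \<times> work_symbols E \<times> UNIV \<times> UNIV))"

lemma finite_rsym: "finite (UNIV :: rsym set)"
proof -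
  have eq: "(UNIV :: rsym set) = insert REnd (RLab ` {Top, Bot} \<union> range RChr)"
    by (auto simp: image_iff) (metis player.exhaust rsym.exhaust)
  show ?thesis by (subst eq) simp
qed

lemma countable_codes: "countable (code ` Collect is_epm)"
proof -
  have "code E \<in> Collect finite \<times> Collect finite \<times> UNIV \<times> Collect finite \<times> Collect finite \<times> Collect finite"
    if "is_epm E" for E
  proof -
    have fin: "finite (states E)" "finite (work_symbols E)"
      using that by (simp_all add: is_epm_def)
    moreover have "finite (move_states E)" "finite (permission_states E)"
      using that fin(1) unfolding is_epm_def by (meson finite_subset)+
    ultimately show ?thesis
      by (simp add: code_def finite_rsym finite_cartesian_product del: UNIV_Times_UNIV)
  qed
  then have "code ` Collect is_epm \<subseteq>
      Collect finite \<times> Collect finite \<times> UNIV \<times> Collect finite \<times> Collect finite \<times> Collect finite"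
    by blast
  then show ?thesis
    by (rule countable_subset) (intro countable_SIGMA countable_Collect_finite countableI_type)
qed

lemma delta_closed:
  assumes "is_epm E" "q \<in> states E" "a \<in> work_symbols E" "delta E q a b r = (q', a', ds)"
  shows "q' \<in> states E" "a' \<in> work_symbols E"
  using assms unfolding is_epm_def by blast+

lemma branch_invariant:
  assumes "is_epm E" "branch E e B"
  shows "state (B n) \<in> states E \<and> range (work (B n)) \<subseteq> work_symbols E"
proof (induction n)
  case 0
  then show ?case using assms by (auto simp: branch_def init_config_def is_epm_def)
next
  case (Suc n)
  let ?C = "B n"
  have "step E e ?C (B (Suc n))" using assms by (simp add: branch_def)
  then obtain q a ds where d: "delta E (state ?C) (work ?C (work_head ?C))
      (valuation_tape e (val_head ?C)) (run_tape (pos ?C) (run_head ?C)) = (q, a, ds)"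
    and eq: "state (B (Suc n)) = q" "work (B (Suc n)) = (work ?C)(work_head ?C := a)"
    by (auto simp: step_def)
  have "q \<in> states E" "a \<in> work_symbols E"
    using delta_closed[OF assms(1) _ _ d] Suc by auto
  then show ?case
    using Suc by (auto simp: eq)
qed

text \<open>A branch never leaves the declared states and work symbols, where the two transition
  functions agree. So every branch of \<open>E'\<close> is a branch of \<open>E\<close>.\<close>

lemma wins_on_code:
  assumes "is_epm E" "code E = code E'" "wins_on E A e"
  shows "wins_on E' A e"
proof -
  have same: "states E' = states E" "work_symbols E' = work_symbols E" "start_state E' = start_state E"
    "move_states E' = move_states E" "permission_states E' = permission_states E"
    using assms(2) by (auto simp: code_def)
  have delta: "delta E' q a b r = delta E q a b r" if "q \<in> states E" "a \<in> work_symbols E" for q a b r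
  proof -
    let ?graph = "\<lambda>E. (\<lambda>(q, a, b, r). ((q, a, b, r), delta E q a b r)) `
      (states E \<times> work_symbols E \<times> UNIV \<times> UNIV)"
    have "((q, a, b, r), delta E q a b r) \<in> ?graph E"
      using that by (intro image_eqI[of _ _ "(q, a, b, r)"]) auto
    moreover have "?graph E = ?graph E'"
      using assms(2) unfolding code_def prod.inject by blast
    ultimately have "((q, a, b, r), delta E q a b r) \<in> ?graph E'" by simp
    then show ?thesis by auto
  qed
  have "\<forall>q\<in>states E. \<forall>a\<in>work_symbols E. \<forall>b r. \<forall>q' a' ds. delta E' q a b r = (q', a', ds) \<longrightarrow>
      q' \<in> states E \<and> a' \<in> work_symbols E"
  proof (intro ballI allI impI)
    fix q a b r q' a' ds
    assume *: "q \<in> states E" "a \<in> work_symbols E" "delta E' q a b r = (q', a', ds)"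
    then have "delta E q a b r = (q', a', ds)" using delta by simp
    then show "q' \<in> states E \<and> a' \<in> work_symbols E"
      using delta_closed[OF assms(1) *(1,2)] by blast
  qed
  \<comment> \<open>This allows \<open>branch_invariant\<close> to be applied to the branches of
    \<open>E'\<close>.\<close>
  then have "is_epm E'"
    using assms(1) unfolding is_epm_def same by (elim conjE) (intro conjI; assumption)
  have "branch E e B" if B: "branch E' e B" for B
    unfolding branch_def
  proof (intro conjI allI)
    show "B 0 = init_config E" using B by (simp add: branch_def init_config_def same)
    fix n
    have "delta E' (state (B n)) (work (B n) i) = delta E (state (B n)) (work (B n) i)" for i
      using branch_invariant[OF \<open>is_epm E'\<close> B, of n] by (auto simp: same intro!: ext delta)
    moreover have "step E' e (B n) (B (Suc n))"
      using B by (simp add: branch_def)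
    ultimately show "step E e (B n) (B (Suc n))"
      by (simp add: step_def same)
  qed
  then show ?thesis
    using assms(3) by (auto simp: wins_on_def fair_def same)
qed

section \<open>An EPM that reads a recoloured tape\<close>

text \<open>A step from a configuration that is not ready is silent and lowers the measure
  \<open>m\<close>, so a ready one recurs; a step from a ready one matches exactly one step of the
  simulated system. \<open>\<tau>\<close> picks ready times at which the two are compared.\<close>

lemma stuttering_simulation:
  assumes "wf r"
    and start: "R m (B 0) c"
    and run: "\<And>n. stp (B n) (B (Suc n))"
    and busy: "\<And>m b b' c. R m b c \<Longrightarrow> \<not> ready b \<Longrightarrow> stp b b' \<Longrightarrow> \<exists>m'. (m', m) \<in> r \<and> R m' b' c"
    and real: "\<And>m b b' c. R m b c \<Longrightarrow> ready b \<Longrightarrow> stp b b' \<Longrightarrow> \<exists>m' c'. stp' c c' \<and> R m' b' c'"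
  obtains f \<tau> where "f 0 = c" "\<And>n. stp' (f n) (f (Suc n))" "strict_mono \<tau>"
    "\<And>n. ready (B (\<tau> n)) \<and> (\<exists>m. R m (B (\<tau> n)) (f n))"
proof -
  have reach: "\<exists>j\<ge>i. ready (B j) \<and> (\<exists>m. R m (B j) c)" if "R m (B i) c" for m i c
    using \<open>wf r\<close> that
  proof (induction m arbitrary: i rule: wf_induct_rule)
    case (less m)
    show ?case
    proof (cases "ready (B i)")
      case True
      then show ?thesis using less.prems by blast
    next
      case False
      then obtain m' where "(m', m) \<in> r" "R m' (B (Suc i)) c"
        using busy[OF less.prems _ run] by blast
      then show ?thesis using less.IH Suc_leD by blast
    qed
  qed
  \<comment> \<open>Dependent choice runs over pairs of a ready time and a simulated configuration;
    the last clause fixes the start.\<close>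
  define P where
    "P n x \<longleftrightarrow> ready (B (fst x)) \<and> (\<exists>m. R m (B (fst x)) (snd x)) \<and> (n = 0 \<longrightarrow> snd x = c)" for n :: nat and x
  have "\<exists>f. \<forall>n. P n (f n) \<and> fst (f n) < fst (f (Suc n)) \<and> stp' (snd (f n)) (snd (f (Suc n)))"
  proof (rule dependent_nat_choice)
    show "\<exists>x. P 0 x"
      using reach[OF start] by (auto simp: P_def)
  next
    fix x n
    assume "P n x"
    then obtain m' c' where "stp' (snd x) c'" "R m' (B (Suc (fst x))) c'"
      unfolding P_def using real run by blast
    then show "\<exists>y. P (Suc n) y \<and> fst x < fst y \<and> stp' (snd x) (snd y)"
      using reach[of m' "Suc (fst x)" c'] by (auto simp: P_def Suc_le_eq)
  qed
  then obtain f where f: "\<And>n. P n (f n)" "\<And>n. fst (f n) < fst (f (Suc n))"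
      "\<And>n. stp' (snd (f n)) (snd (f (Suc n)))"
    by blast
  show thesis
  proof (rule that[of "snd \<circ> f" "fst \<circ> f"])
    show "strict_mono (fst \<circ> f)"
      using f(2) by (simp add: strict_mono_Suc_iff)
    show "ready (B ((fst \<circ> f) n)) \<and> (\<exists>m. R m (B ((fst \<circ> f) n)) ((snd \<circ> f) n))" for n
      using f(1)[of n] by (simp add: P_def)
  qed (use f P_def in auto)
qed

section \<open>The control of the simulating machine\<close>

datatype pending = Idle | Inc | Back

text \<open>The arguments of a control state are the state of \<open>E\<close>, the index of the scanned entry capped at \<open>M\<close>,
  the pending counter operation, and the symbol of \<open>E\<close> that is temporarily replaced by a mark on the work
  tape. A step of \<open>E\<close> leads from \<open>Ready\<close> to \<open>Post\<close>. Only \<open>Post\<close> may be a move state and only \<open>Ready\<close> a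
  permission state, so the other states are invisible to the environment.\<close>

datatype hstate =
    Init
  | Ready nat nat
  | Post nat nat pending
  | House nat nat pending
  | Extend nat nat pending
  | SeekInc nat nat wsym
  | Append nat nat pending wsym
  | SeekDec nat wsym
  | EndDec nat wsym
  | Erase nat wsym
  | Return nat nat pending wsym

instance pending :: countable
  by countable_datatype

instance hstate :: countable
  by countable_datatype

text \<open>\<open>G s b\<close> is the symbol shown to \<open>E\<close> in place of
  \<open>b\<close> in entry \<open>s\<close>. \<open>hash\<close> separates the tape of
  \<open>E\<close> from the unary counter made of \<open>tally\<close>, and \<open>mark\<close>
  holds the place of the work head during an excursion to the counter.\<close>

locale recolouring =
  fixes E :: epm and M :: nat and G :: "nat \<Rightarrow> char \<Rightarrow> char" and hash tally mark :: wsym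
  assumes epm: "is_epm E"
    and M: "0 < M"
    and new: "hash \<notin> work_symbols E" "tally \<notin> work_symbols E" "mark \<notin> work_symbols E"
      "hash \<noteq> tally" "hash \<noteq> mark" "tally \<noteq> mark"
begin

text \<open>Leaving a comma to the right is noticed before the head moves; entering one from the
  right only at the new cell, so \<open>Back\<close> leaves the decision to \<open>House\<close>.
  When \<open>E\<close> reaches the separator, \<open>Extend\<close> shifts it by one cell; if this
  overwrites a tally, \<open>Append\<close> adds one at the far end. The idle clause of
  \<open>Ready\<close> keeps the control inside the valid states, as nothing is known of
  \<open>delta E\<close> on foreign symbols.\<close>

fun tr :: "hstate \<Rightarrow> wsym \<Rightarrow> char \<Rightarrow> rsym \<Rightarrow> hstate \<times> wsym \<times> dir \<times> dir \<times> dir" where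
  "tr Init a b r = (House (start_state E) 0 Idle, hash, Stay, Stay, Stay)"
| "tr (Ready q s) a b r =
     (if a \<in> work_symbols E
      then case delta E q a (G s b) r of (q', a', dw, dv, dr) \<Rightarrow>
        (if dv = Rgt \<and> b = CHR '','' then (if s < M then Post q' (Suc s) Idle else Post q' s Inc)
         else if dv = Lft then Post q' s Back
         else Post q' s Idle, a', dw, dv, dr)
      else (Ready q s, a, Stay, Stay, Stay))"
| "tr (Post q s p) a b r = (House q s p, a, Stay, Stay, Stay)"
| "tr (House q s p) a b r =
     (if a = hash then (Extend q s p, mark, Rgt, Stay, Stay)
      else if p = Inc then (SeekInc q s a, mark, Rgt, Stay, Stay)
      else if p = Back \<and> b = CHR '','' then
        (if s < M then (Ready q (s - 1), a, Stay, Stay, Stay) else (SeekDec q a, mark, Rgt, Stay, Stay))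
      else (Ready q s, a, Stay, Stay, Stay))"
| "tr (Extend q s p) a b r =
     (if a = Blank then (Return q s p Blank, hash, Lft, Stay, Stay)
      else (Append q s p Blank, hash, Rgt, Stay, Stay))"
| "tr (SeekInc q s x) a b r =
     (if a = hash then (Append q s Idle x, a, Rgt, Stay, Stay)
      else (SeekInc q s x, a, Rgt, Stay, Stay))"
| "tr (Append q s p x) a b r =
     (if a = Blank then (Return q s p x, tally, Lft, Stay, Stay)
      else (Append q s p x, a, Rgt, Stay, Stay))"
| "tr (SeekDec q x) a b r =
     (if a = hash then (EndDec q x, a, Rgt, Stay, Stay)
      else (SeekDec q x, a, Rgt, Stay, Stay))"
| "tr (EndDec q x) a b r =
     (if a = Blank then (Erase q x, a, Lft, Stay, Stay)
      else (EndDec q x, a, Rgt, Stay, Stay))"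
| "tr (Erase q x) a b r =
     (if a = hash then (Return q (M - 1) Idle x, a, Lft, Stay, Stay)
      else (Return q M Idle x, Blank, Lft, Stay, Stay))"
| "tr (Return q s p x) a b r =
     (if a = mark then (House q s p, x, Stay, Stay, Stay)
      else (Return q s p x, a, Lft, Stay, Stay))"

definition syms :: "wsym set" where
  "syms = work_symbols E \<union> {hash, tally, mark}"

fun valid_state :: "hstate \<Rightarrow> bool" where
  "valid_state Init = True"
| "valid_state (Ready q s) = (q \<in> states E \<and> s \<le> M)"
| "valid_state (Post q s p) = (q \<in> states E \<and> s \<le> M)"
| "valid_state (House q s p) = (q \<in> states E \<and> s \<le> M)"
| "valid_state (Extend q s p) = (q \<in> states E \<and> s \<le> M)"
| "valid_state (SeekInc q s x) = (q \<in> states E \<and> s \<le> M \<and> x \<in> syms)"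
| "valid_state (Append q s p x) = (q \<in> states E \<and> s \<le> M \<and> x \<in> syms)"
| "valid_state (SeekDec q x) = (q \<in> states E \<and> x \<in> syms)"
| "valid_state (EndDec q x) = (q \<in> states E \<and> x \<in> syms)"
| "valid_state (Erase q x) = (q \<in> states E \<and> x \<in> syms)"
| "valid_state (Return q s p x) = (q \<in> states E \<and> s \<le> M \<and> x \<in> syms)"

fun moving :: "hstate \<Rightarrow> bool" where
  "moving (Post q s p) = (q \<in> move_states E)"
| "moving _ = False"

fun permitting :: "hstate \<Rightarrow> bool" where
  "permitting (Ready q s) = (q \<in> permission_states E)"
| "permitting _ = False"

definition machine :: epm where
  "machine = \<lparr>states = to_nat ` Collect valid_state, work_symbols = syms, start_state = to_nat Init,
     move_states = to_nat ` {h. valid_state h \<and> moving h},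
     permission_states = to_nat ` {h. valid_state h \<and> permitting h},
     delta = (\<lambda>n a b r. apfst to_nat (tr (from_nat n) a b r))\<rparr>"

lemma finite_valid_states: "finite (Collect valid_state)"
proof -
  have fin: "finite (states E)" "finite syms"
    using epm by (auto simp: is_epm_def syms_def)
  have p: "finite (UNIV :: pending set)"
    by (rule finite_subset[of _ "{Idle, Inc, Back}"]) (auto intro: pending.exhaust)
  let ?Q = "states E" and ?S = "{..M}"
  have "Collect valid_state \<subseteq> {Init} \<union> case_prod Ready ` (?Q \<times> ?S)
     \<union> (\<lambda>(q, s, p). Post q s p) ` (?Q \<times> ?S \<times> UNIV)
     \<union> (\<lambda>(q, s, p). House q s p) ` (?Q \<times> ?S \<times> UNIV)
     \<union> (\<lambda>(q, s, p). Extend q s p) ` (?Q \<times> ?S \<times> UNIV)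
     \<union> (\<lambda>(q, s, x). SeekInc q s x) ` (?Q \<times> ?S \<times> syms)
     \<union> (\<lambda>(q, s, p, x). Append q s p x) ` (?Q \<times> ?S \<times> UNIV \<times> syms)
     \<union> case_prod SeekDec ` (?Q \<times> syms) \<union> case_prod EndDec ` (?Q \<times> syms)
     \<union> case_prod Erase ` (?Q \<times> syms)
     \<union> (\<lambda>(q, s, p, x). Return q s p x) ` (?Q \<times> ?S \<times> UNIV \<times> syms)" (is "_ \<subseteq> ?A")
  proof
    fix h
    assume "h \<in> Collect valid_state"
    then show "h \<in> ?A"
      by (cases h) (force simp: image_iff)+
  qed
  moreover have "finite ?A"
    using fin p by (intro finite_UnI finite_imageI finite_cartesian_product) auto
  ultimately show ?thesis
    by (rule finite_subset)
qed

lemma tr_closed: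
  assumes "valid_state h" "a \<in> syms"
  shows "valid_state (fst (tr h a b r)) \<and> fst (snd (tr h a b r)) \<in> syms"
proof -
  have B: "Blank \<in> syms" "hash \<in> syms" "tally \<in> syms" "mark \<in> syms" "start_state E \<in> states E"
    using epm by (auto simp: is_epm_def syms_def)
  show ?thesis
  proof (cases h)
    case (Ready q s)
    show ?thesis
    proof (cases "a \<in> work_symbols E")
      case True
      obtain q1 a1 dw dv dr where d: "delta E q a (G s b) r = (q1, a1, dw, dv, dr)"
        by (cases "delta E q a (G s b) r") auto
      have "q1 \<in> states E" "a1 \<in> syms"
        using delta_closed[OF epm _ True d] assms(1) Ready by (auto simp: syms_def)
      then show ?thesis
        using assms Ready True d by simp
    next
      case False
      then show ?thesis using assms Ready by simp
    qed
  qed (use assms B in auto)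
qed

lemma is_epm_machine: "is_epm machine"
proof -
  have "finite syms" "insert Blank (range Chr) \<subseteq> syms"
    using epm by (auto simp: is_epm_def syms_def)
  moreover have "to_nat ` {h. valid_state h \<and> moving h} \<inter> to_nat ` {h. valid_state h \<and> permitting h} = {}"
    by (auto elim: moving.elims permitting.elims)
  moreover have "q' \<in> to_nat ` Collect valid_state \<and> a' \<in> syms"
    if "valid_state h" "a \<in> syms" "apfst to_nat (tr h a b r) = (q', a', ds)" for h a b r q' a' ds
    using tr_closed[OF that(1,2), of b r] that(3) by (cases "tr h a b r") auto
  ultimately show ?thesis
    using finite_valid_states unfolding is_epm_def machine_def by auto
qed


section \<open>The layout of the work tape\<close>

text \<open>The work tape \<open>t\<close> of \<open>E\<close>, used only below cell \<open>L\<close>, together with the counter value \<open>c\<close>. As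
  \<open>hash\<close> stands where \<open>t\<close> has a blank, the two tapes spell the same move.\<close>

definition layout :: "(nat \<Rightarrow> wsym) \<Rightarrow> nat \<Rightarrow> nat \<Rightarrow> nat \<Rightarrow> wsym" where
  "layout t L c i = (if i < L then t i else if i = L then hash else if i \<le> L + c then tally else Blank)"

definition blank_from :: "nat \<Rightarrow> (nat \<Rightarrow> wsym) \<Rightarrow> bool" where
  "blank_from L t \<longleftrightarrow> (\<forall>i\<ge>L. t i = Blank)"

lemma new_not_move: "hash \<notin> range Chr" "Blank \<noteq> hash" "Blank \<noteq> tally" "Blank \<noteq> mark"
  using epm new by (auto simp: is_epm_def)

text \<open>Cell \<open>L\<close> holds no move symbol on either tape, so both moves end at or
  before \<open>L\<close>, and below \<open>L\<close> the tapes coincide.\<close>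

lemma work_move_layout:
  assumes "blank_from L t"
  shows "work_move (layout t L c) = work_move t"
proof -
  let ?P = "\<lambda>n. layout t L c n \<notin> range Chr" and ?Q = "\<lambda>n. t n \<notin> range Chr"
  have PQ: "?P n \<longleftrightarrow> ?Q n" if "n \<le> L" for n
    using that assms new_not_move by (auto simp: layout_def blank_from_def)
  have Q: "?Q L"
    using assms by (auto simp: blank_from_def)
  have P: "?P L" using PQ Q by blast
  have "Least ?P \<le> L" "Least ?Q \<le> L"
    using P Q by (auto intro: Least_le)
  then have eq: "Least ?P = Least ?Q"
    using LeastI[of ?P L, OF P] LeastI[of ?Q L, OF Q] PQ
    by (metis (no_types, lifting) Least_le antisym)
  show ?thesis
    unfolding work_move_def eq
  proof (rule map_cong[OF refl])
    fix i
    assume "i \<in> set [0..<Least ?Q]"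
    then have "i < L" using \<open>Least ?Q \<le> L\<close> by simp
    then show "(case layout t L c i of Chr a \<Rightarrow> a) = (case t i of Chr a \<Rightarrow> a)"
      by (simp add: layout_def)
  qed
qed

lemma machine_step:
  assumes "step machine e C D" "state C = to_nat h"
    "tr h (work C (work_head C)) (valuation_tape e (val_head C)) (run_tape (pos C) (run_head C))
      = (h', a, dw, dv, dr)"
    "\<not> permitting h" "\<not> moving h'"
  shows "D = \<lparr>state = to_nat h', work = (work C)(work_head C := a),
     work_head = move_head dw (work_head C), val_head = move_head dv (val_head C),
     run_head = move_head dr (run_head C), pos = pos C\<rparr>"
  using assms by (auto simp: step_def machine_def)

end

section \<open>The correspondence with the simulated computation\<close>

locale recoloured_valuation = recolouring +
  fixes e e' :: valuation
  assumes tape: "\<And>v. valuation_tape e' v = G (min (seg (valuation_tape e) v) M) (valuation_tape e v)"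
    and first: "valuation_tape e 0 \<noteq> CHR '',''"
begin

abbreviation S :: "nat \<Rightarrow> nat" where
  "S \<equiv> seg (valuation_tape e)"

text \<open>The entry that was scanned before a step to the left: only such a step can have led onto a comma
  from the next entry. In cell 0 the head does not move, but there is no comma there.\<close>

definition S' :: "nat \<Rightarrow> nat" where
  "S' v = (if valuation_tape e v = CHR '','' then Suc (S v) else S v)"

text \<open>With \<open>Idle\<close>, index and counter are right for the scanned cell. With
  \<open>Inc\<close> the counter is one short; with \<open>Back\<close> both are still right for the
  entry scanned before the step to the left.\<close>

fun pend :: "pending \<Rightarrow> nat \<Rightarrow> nat \<Rightarrow> nat \<Rightarrow> bool" where
  "pend Idle s c v = (s = min (S v) M \<and> c = S v - M)"
| "pend Inc s c v = (s = M \<and> S v = Suc (M + c))"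
| "pend Back s c v = (s = min (S' v) M \<and> c = S' v - M)"

text \<open>An extension may be followed by a second excursion for the pending operation, whose
  stages have levels 6 down to 1. The offset 6 puts the end of the first excursion above
  them.\<close>

definition rank :: "pending \<Rightarrow> nat" where
  "rank p = (if p = Idle then 0 else 6)"

text \<open>The correspondence between the work tape \<open>t\<close> and work head \<open>w\<close> of the simulating machine and the
  simulated configuration \<open>C\<close>. The pair \<open>m\<close> decreases lexicographically until \<open>Ready\<close> is reached.\<close>

fun shape :: "hstate \<Rightarrow> nat \<Rightarrow> nat \<Rightarrow> nat \<times> nat \<Rightarrow> (nat \<Rightarrow> wsym) \<Rightarrow> nat \<Rightarrow> config \<Rightarrow> bool" where
  "shape Init L c m t w C = (C = init_config E \<and> t = (\<lambda>_. Blank) \<and> w = 0 \<and> m = (12, 0))"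
| "shape (Ready q s) L c m t w C = (q = state C \<and> blank_from L (work C) \<and> pend Idle s c (val_head C) \<and>
     t = layout (work C) L c \<and> w = work_head C \<and> w < L \<and> m = (0, 0))"
| "shape (Post q s p) L c m t w C = (q = state C \<and> blank_from L (work C) \<and> pend p s c (val_head C) \<and>
     t = layout (work C) L c \<and> w = work_head C \<and> w \<le> L \<and> m = (12, 0))"
| "shape (House q s p) L c m t w C = (q = state C \<and> blank_from L (work C) \<and> pend p s c (val_head C) \<and>
     t = layout (work C) L c \<and> w = work_head C \<and> w \<le> L \<and> m = (if w = L then 11 else 1 + rank p, 0))"
| "shape (Extend q s p) L c m t w C = (q = state C \<and> blank_from L (work C) \<and> pend p s c (val_head C) \<and>
     t = (layout (work C) L c)(L := mark) \<and> work_head C = L \<and> w = Suc L \<and> m = (10, 0))"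
| "shape (SeekInc q s x) L c m t w C = (q = state C \<and> blank_from L (work C) \<and> pend Inc s c (val_head C) \<and>
     t = (layout (work C) L c)(work_head C := mark) \<and> x = work C (work_head C) \<and>
     work_head C < w \<and> w \<le> L \<and> m = (6, L - w))"
| "shape (Append q s p x) L c m t w C = (q = state C \<and> blank_from L (work C) \<and> pend p s (Suc c) (val_head C) \<and>
     t = (layout (work C) L c)(work_head C := mark) \<and> x = work C (work_head C) \<and>
     work_head C < L \<and> L < w \<and> w \<le> Suc (L + c) \<and> m = (3 + rank p, Suc (L + c) - w))"
| "shape (SeekDec q x) L c m t w C = (q = state C \<and> blank_from L (work C) \<and> pend Back M c (val_head C) \<and>
     valuation_tape e (val_head C) = CHR '','' \<and>
     t = (layout (work C) L c)(work_head C := mark) \<and> x = work C (work_head C) \<and>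
     work_head C < w \<and> w \<le> L \<and> m = (6, L - w))"
| "shape (EndDec q x) L c m t w C = (q = state C \<and> blank_from L (work C) \<and> pend Back M c (val_head C) \<and>
     valuation_tape e (val_head C) = CHR '','' \<and>
     t = (layout (work C) L c)(work_head C := mark) \<and> x = work C (work_head C) \<and>
     work_head C < L \<and> L < w \<and> w \<le> Suc (L + c) \<and> m = (5, Suc (L + c) - w))"
| "shape (Erase q x) L c m t w C = (q = state C \<and> blank_from L (work C) \<and> pend Back M c (val_head C) \<and>
     valuation_tape e (val_head C) = CHR '','' \<and>
     t = (layout (work C) L c)(work_head C := mark) \<and> x = work C (work_head C) \<and>
     work_head C < L \<and> w = L + c \<and> m = (4, 0))"
| "shape (Return q s p x) L c m t w C = (q = state C \<and> blank_from L (work C) \<and> pend p s c (val_head C) \<and>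
     t = (layout (work C) L c)(work_head C := mark) \<and> x = work C (work_head C) \<and>
     work_head C < L \<and> work_head C \<le> w \<and> m = (2 + rank p, w))"

definition aligned :: "config \<Rightarrow> config \<Rightarrow> bool" where
  "aligned B C \<longleftrightarrow> val_head B = val_head C \<and> run_head B = run_head C \<and> pos B = pos C \<and>
     state C \<in> states E \<and> range (work C) \<subseteq> work_symbols E"

definition sim :: "nat \<times> nat \<Rightarrow> config \<Rightarrow> config \<Rightarrow> bool" where
  "sim m B C \<longleftrightarrow> aligned B C \<and> (\<exists>h L c. state B = to_nat h \<and> shape h L c m (work B) (work_head B) C)"

definition is_ready :: "config \<Rightarrow> bool" where
  "is_ready B \<longleftrightarrow> (\<exists>q s. state B = to_nat (Ready q s))"

lemma pend_le: "pend p s c v \<Longrightarrow> s \<le> M"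
  by (cases p) auto

lemma sim_start: "sim (12, 0) (init_config machine) (init_config E)"
  using epm by (auto simp: sim_def aligned_def init_config_def machine_def is_epm_def intro!: exI[of _ Init])

definition busy_less :: "((nat \<times> nat) \<times> nat \<times> nat) set" where
  "busy_less = less_than <*lex*> less_than"

text \<open>\<open>L\<close> and \<open>c\<close> are chosen anew because housekeeping may shift the
  separator or change the counter; the simulated configuration \<open>C\<close> stays fixed.\<close>

definition next_ok :: "hstate \<Rightarrow> nat \<times> nat \<Rightarrow> (nat \<Rightarrow> wsym) \<Rightarrow> nat \<Rightarrow> rsym \<Rightarrow> config \<Rightarrow> bool" where
  "next_ok h m t w r C \<longleftrightarrow> (\<exists>h' L c a dw m'. tr h (t w) (valuation_tape e (val_head C)) r = (h', a, dw, Stay, Stay) \<and>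
     \<not> moving h' \<and> (m', m) \<in> busy_less \<and> shape h' L c m' (t(w := a)) (move_head dw w) C)"

lemma next_okI:
  assumes "tr h (t w) (valuation_tape e (val_head C)) r = (h', a, dw, Stay, Stay)"
    "\<not> moving h'" "(m', m) \<in> busy_less" "shape h' L c m' (t(w := a)) (move_head dw w) C"
  shows "next_ok h m t w r C"
  using assms unfolding next_ok_def by blast

section \<open>Progress of the housekeeping steps\<close>

lemma layout_extend: "(layout t w 0)(w := mark, Suc w := hash) = (layout t (Suc w) 0)(w := mark)"
  if "t w = Blank"
  by (rule ext) (auto simp: layout_def)

lemma layout_extend_Suc: "(layout t w (Suc k))(w := mark, Suc w := hash) = (layout t (Suc w) k)(w := mark)"
  if "t w = Blank"
  by (rule ext) (auto simp: layout_def)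

lemma layout_append: "(layout t L k)(w := mark, Suc (L + k) := tally) = (layout t L (Suc k))(w := mark)" if "w < L"
  using that by (auto simp: layout_def fun_eq_iff)

lemma layout_erase: "(layout t L (Suc c))(w := mark, Suc (L + c) := Blank) = (layout t L c)(w := mark)" if "w < L"
  using that by (auto simp: layout_def fun_eq_iff)

lemma layout_restore: "(layout t L c)(w := t w) = layout t L c" if "w < L"
  using that by (auto simp: layout_def fun_eq_iff)

text \<open>The separator starts in cell 0, under the work head, so the first \<open>House\<close>
  step leads to an extension.\<close>

lemma next_Init: "shape Init L c m t w C \<Longrightarrow> next_ok Init m t w r C"
  by (rule next_okI[where L = 0 and c = 0 and h' = "House (start_state E) 0 Idle"
        and a = hash and dw = Stay and m' = "(11, 0)"])
    (auto simp: busy_less_def init_config_def blank_from_def layout_def fun_eq_iff)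

lemma next_Post:
  assumes sh: "shape (Post q s p) L c m t w C"
  shows "next_ok (Post q s p) m t w r C"
proof -
  from sh have *: "q = state C" "blank_from L (work C)" "pend p s c (val_head C)"
    "t = layout (work C) L c" "w = work_head C" "w \<le> L" "m = (12, 0)"
    by auto
  show ?thesis
    by (rule next_okI[where L = L and c = c and h' = "House q s p" and a = "t w" and dw = Stay
          and m' = "(if w = L then 11 else 1 + rank p, 0)"])
      (use * in \<open>auto simp: busy_less_def rank_def\<close>)
qed

lemma next_House:
  assumes sh: "shape (House q s p) L c m t w C" and alien: "range (work C) \<subseteq> work_symbols E"
  shows "next_ok (House q s p) m t w r C"
proof -
  from sh have *: "q = state C" "blank_from L (work C)" "pend p s c (val_head C)"
    "t = layout (work C) L c" "w = work_head C" "w \<le> L" "m = (if w = L then 11 else 1 + rank p, 0)"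
    by auto
  show ?thesis
  proof (cases "w = L")
    case True
    show ?thesis
      by (rule next_okI[where L = L and c = c and h' = "Extend q s p"
            and a = mark and dw = Rgt and m' = "(10, 0)"])
        (use * True in \<open>auto simp: busy_less_def layout_def\<close>)
  next
    case False
    then have w: "w < L" using * by simp
    then have tw: "t w = work C w" "t w \<noteq> hash"
      using * alien new by (auto simp: layout_def)
    \<comment> \<open>A deferred increment; a comma entered from the right, below the cap or at it;
      or nothing left to do.\<close>
    consider "p = Inc" | "p = Back" "valuation_tape e (val_head C) = CHR '',''" "s < M"
      | "p = Back" "valuation_tape e (val_head C) = CHR '',''" "s = M"
      | "p = Back \<and> valuation_tape e (val_head C) \<noteq> CHR '','' \<or> p = Idle"
      using pend_le[OF *(3)] by (cases p) (auto simp: le_less)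
    then show ?thesis
    proof cases
      case 1
      show ?thesis
        by (rule next_okI[where L = L and c = c and h' = "SeekInc q s (t w)"
              and a = mark and dw = Rgt and m' = "(6, L - Suc w)"])
          (use * w tw 1 in \<open>auto simp: busy_less_def rank_def\<close>)
    next
      case 2
      show ?thesis
        by (rule next_okI[where L = L and c = c and h' = "Ready q (s - 1)"
              and a = "t w" and dw = Stay and m' = "(0, 0)"])
          (use * w tw 2 in \<open>auto simp: busy_less_def rank_def S'_def\<close>)
    next
      case 3
      show ?thesis
        by (rule next_okI[where L = L and c = c and h' = "SeekDec q (t w)"
              and a = mark and dw = Rgt and m' = "(6, L - Suc w)"])
          (use * w tw 3 in \<open>auto simp: busy_less_def rank_def\<close>)
    next
      case 4
      show ?thesis
        by (rule next_okI[where L = L and c = c and h' = "Ready q s"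
              and a = "t w" and dw = Stay and m' = "(0, 0)"])
          (use * w tw 4 in \<open>auto simp: busy_less_def rank_def S'_def\<close>)
    qed
  qed
qed

lemma next_Extend:
  assumes sh: "shape (Extend q s p) L c m t w C"
  shows "next_ok (Extend q s p) m t w r C"
proof -
  from sh have *: "q = state C" "blank_from L (work C)" "pend p s c (val_head C)"
     "t = (layout (work C) L c)(L := mark)" "work_head C = L" "w = Suc L" "m = (10, 0)"
    by auto
  have L: "work C L = Blank" "blank_from (Suc L) (work C)"
    using *(2) by (auto simp: blank_from_def)
  show ?thesis
  proof (cases c)
    case 0
    show ?thesis
      by (rule next_okI[where L = "Suc L" and c = 0 and h' = "Return q s p Blank"
            and a = hash and dw = Lft and m' = "(2 + rank p, L)"])
        (use * L 0 in \<open>auto simp: busy_less_def rank_def layout_def layout_extend\<close>)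
  next
    \<comment> \<open>The shifted separator swallows one tally: the tape shows \<open>k\<close>
      although the count is \<open>Suc k\<close>, which is the mismatch that \<open>Append\<close>
      expects.\<close>
    case (Suc k)
    then have "t w \<noteq> Blank"
      using * new_not_move by (auto simp: layout_def)
    then show ?thesis
      by (intro next_okI[where L = "Suc L" and c = k and h' = "Append q s p Blank"
            and a = hash and dw = Rgt and m' = "(3 + rank p, k)"])
        (use * L Suc in \<open>auto simp: busy_less_def rank_def layout_extend_Suc\<close>)
  qed
qed

lemma next_SeekInc:
  assumes sh: "shape (SeekInc q s x) L c m t w C" and alien: "range (work C) \<subseteq> work_symbols E"
  shows "next_ok (SeekInc q s x) m t w r C"
proof -
  from sh have *: "q = state C" "blank_from L (work C)" "pend Inc s c (val_head C)"
     "t = (layout (work C) L c)(work_head C := mark)" "x = work C (work_head C)"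
     "work_head C < w" "w \<le> L" "m = (6, L - w)"
    by auto
  show ?thesis
  proof (cases "w = L")
    case True
    show ?thesis
      by (rule next_okI[where L = L and c = c and h' = "Append q s Idle x"
            and a = hash and dw = Rgt and m' = "(3, c)"])
        (use * True in \<open>auto simp: busy_less_def rank_def layout_def\<close>)
  next
    case False
    then have "t w \<noteq> hash"
      using * alien new by (auto simp: layout_def)
    then show ?thesis
      by (intro next_okI[where L = L and c = c and h' = "SeekInc q s x"
            and a = "t w" and dw = Rgt and m' = "(6, L - Suc w)"])
        (use * False in \<open>auto simp: busy_less_def\<close>)
  qed
qed

lemma next_Append:
  assumes sh: "shape (Append q s p x) L c m t w C"
  shows "next_ok (Append q s p x) m t w r C"
proof -
  from sh have *: "q = state C" "blank_from L (work C)" "pend p s (Suc c) (val_head C)"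
     "t = (layout (work C) L c)(work_head C := mark)" "x = work C (work_head C)"
     "work_head C < L" "L < w" "w \<le> Suc (L + c)" "m = (3 + rank p, Suc (L + c) - w)"
    by auto
  show ?thesis
  proof (cases "w = Suc (L + c)")
    case True
    have "t w = Blank" using * True by (auto simp: layout_def)
    then show ?thesis
      by (intro next_okI[where L = L and c = "Suc c" and h' = "Return q s p x"
            and a = tally and dw = Lft and m' = "(2 + rank p, L + c)"])
        (use * True in \<open>auto simp: busy_less_def rank_def layout_append simp del: pend.simps\<close>)
  next
    case False
    then have "t w \<noteq> Blank"
      using * new_not_move by (auto simp: layout_def)
    then show ?thesis
      by (intro next_okI[where L = L and c = c and h' = "Append q s p x"
            and a = "t w" and dw = Rgt and m' = "(3 + rank p, L + c - w)"])
        (use * False in \<open>auto simp: busy_less_def simp del: pend.simps\<close>)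
  qed
qed

lemma next_SeekDec:
  assumes sh: "shape (SeekDec q x) L c m t w C" and alien: "range (work C) \<subseteq> work_symbols E"
  shows "next_ok (SeekDec q x) m t w r C"
proof -
  from sh have *: "q = state C" "blank_from L (work C)" "pend Back M c (val_head C)"
     "valuation_tape e (val_head C) = CHR '',''"
     "t = (layout (work C) L c)(work_head C := mark)" "x = work C (work_head C)"
     "work_head C < w" "w \<le> L" "m = (6, L - w)"
    by auto
  show ?thesis
  proof (cases "w = L")
    case True
    show ?thesis
      by (rule next_okI[where L = L and c = c and h' = "EndDec q x"
            and a = hash and dw = Rgt and m' = "(5, c)"])
        (use * True in \<open>auto simp: busy_less_def layout_def\<close>)
  next
    case False
    then have "t w \<noteq> hash"
      using * alien new by (auto simp: layout_def)
    then show ?thesis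
      by (intro next_okI[where L = L and c = c and h' = "SeekDec q x"
            and a = "t w" and dw = Rgt and m' = "(6, L - Suc w)"])
        (use * False in \<open>auto simp: busy_less_def\<close>)
  qed
qed

lemma next_EndDec:
  assumes sh: "shape (EndDec q x) L c m t w C"
  shows "next_ok (EndDec q x) m t w r C"
proof -
  from sh have *: "q = state C" "blank_from L (work C)" "pend Back M c (val_head C)"
     "valuation_tape e (val_head C) = CHR '',''"
     "t = (layout (work C) L c)(work_head C := mark)" "x = work C (work_head C)"
     "work_head C < L" "L < w" "w \<le> Suc (L + c)" "m = (5, Suc (L + c) - w)"
    by auto
  show ?thesis
  proof (cases "w = Suc (L + c)")
    case True
    have "t w = Blank" using * True by (auto simp: layout_def)
    then show ?thesis
      by (intro next_okI[where L = L and c = c and h' = "Erase q x"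
            and a = Blank and dw = Lft and m' = "(4, 0)"])
        (use * True in \<open>auto simp: busy_less_def layout_def fun_eq_iff\<close>)
  next
    case False
    then have "t w \<noteq> Blank"
      using * new_not_move by (auto simp: layout_def)
    then show ?thesis
      by (intro next_okI[where L = L and c = c and h' = "EndDec q x"
            and a = "t w" and dw = Rgt and m' = "(5, L + c - w)"])
        (use * False in \<open>auto simp: busy_less_def\<close>)
  qed
qed

text \<open>If no tally is left, the head finds \<open>hash\<close>: the entry just left had index
  \<open>M\<close>, so the new index \<open>M - 1\<close> fits into the finite control again.
  Otherwise one tally goes and the index stays capped.\<close>

lemma next_Erase:
  assumes sh: "shape (Erase q x) L c m t w C"
  shows "next_ok (Erase q x) m t w r C"
proof -
  from sh have *: "q = state C" "blank_from L (work C)" "pend Back M c (val_head C)"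
     "valuation_tape e (val_head C) = CHR '',''"
     "t = (layout (work C) L c)(work_head C := mark)" "x = work C (work_head C)"
     "work_head C < L" "w = L + c" "m = (4, 0)"
    by auto
  show ?thesis
  proof (cases c)
    case 0
    show ?thesis
      by (rule next_okI[where L = L and c = 0 and h' = "Return q (M - 1) Idle x"
            and a = hash and dw = Lft and m' = "(2, L - 1)"])
        (use * 0 in \<open>auto simp: busy_less_def layout_def fun_eq_iff rank_def S'_def\<close>)
  next
    case (Suc k)
    have "t w \<noteq> hash"
      using * Suc new by (auto simp: layout_def)
    moreover have "S (val_head C) = M + k"
      using *(3,4) Suc by (auto simp: S'_def min_def split: if_splits)
    ultimately show ?thesis
      by (intro next_okI[where L = L and c = k and h' = "Return q M Idle x"
            and a = Blank and dw = Lft and m' = "(2, L + k)"])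
        (use *(1,2,4-9) Suc in \<open>auto simp: busy_less_def layout_erase rank_def\<close>)
  qed
qed

lemma next_Return:
  assumes sh: "shape (Return q s p x) L c m t w C" and alien: "range (work C) \<subseteq> work_symbols E"
  shows "next_ok (Return q s p x) m t w r C"
proof -
  from sh have *: "q = state C" "blank_from L (work C)" "pend p s c (val_head C)"
     "t = (layout (work C) L c)(work_head C := mark)" "x = work C (work_head C)"
     "work_head C < L" "work_head C \<le> w" "m = (2 + rank p, w)"
    by auto
  show ?thesis
  proof (cases "w = work_head C")
    case True
    show ?thesis
      by (rule next_okI[where L = L and c = c and h' = "House q s p"
            and a = x and dw = Stay and m' = "(1 + rank p, 0)"])
        (use * True in \<open>auto simp: busy_less_def layout_restore\<close>)
  next
    case False
    have "t w \<noteq> mark"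
      using * False new new_not_move alien by (auto simp: layout_def)
    then show ?thesis
      by (intro next_okI[where L = L and c = c and h' = "Return q s p x"
            and a = "t w" and dw = Lft and m' = "(2 + rank p, w - 1)"])
        (use * False in \<open>auto simp: busy_less_def\<close>)
  qed
qed

lemma busy_step:
  assumes sim: "sim m B C" and busy: "\<not> is_ready B" and step: "step machine e B D"
  shows "\<exists>m'. (m', m) \<in> busy_less \<and> sim m' D C"
proof -
  from sim obtain h L c where al: "aligned B C" and h: "state B = to_nat h"
    and sh: "shape h L c m (work B) (work_head B) C"
    by (auto simp: sim_def)
  have alien: "range (work C) \<subseteq> work_symbols E" and v: "val_head B = val_head C"
    using al by (auto simp: aligned_def)
  have "next_ok h m (work B) (work_head B) (run_tape (pos B) (run_head B)) C \<and> \<not> permitting h"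
  proof (cases h)
    case (Ready q s)
    then show ?thesis using busy h by (auto simp: is_ready_def)
  qed (use sh alien next_Init next_Post next_House next_Extend next_SeekInc next_Append
      next_SeekDec next_EndDec next_Erase next_Return in \<open>simp_all del: shape.simps\<close>)
  then obtain h' L c a dw m' where n: "tr h (work B (work_head B)) (valuation_tape e (val_head B))
       (run_tape (pos B) (run_head B)) = (h', a, dw, Stay, Stay)" "\<not> moving h'" "(m', m) \<in> busy_less"
     "shape h' L c m' ((work B)(work_head B := a)) (move_head dw (work_head B)) C" "\<not> permitting h"
    by (auto simp: next_ok_def v)
  have "sim m' D C"
    using machine_step[OF step h n(1,5,2)] al n(4) by (auto simp: sim_def aligned_def)
  then show ?thesis using n(3) by blast
qed

section \<open>Simulated steps and the transfer of wins\<close>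

lemma step_det:
  assumes "step E' e'' C D"
    "delta E' (state C) (work C (work_head C)) (valuation_tape e'' (val_head C))
      (run_tape (pos C) (run_head C)) = (q, a, dw, dv, dr)"
  shows "\<exists>ms. (ms = [] \<or> state C \<in> permission_states E' \<and> (\<exists>\<beta>. ms = [(Bot, \<beta>)])) \<and>
    D = \<lparr>state = q, work = (work C)(work_head C := a), work_head = move_head dw (work_head C),
      val_head = move_head dv (val_head C), run_head = move_head dr (run_head C),
      pos = pos C @ ms @ (if q \<in> move_states E'
        then [(Top, work_move ((work C)(work_head C := a)))] else [])\<rparr>"
  using assms by (auto simp: step_def)

lemma blank_from_upd: "blank_from L t \<Longrightarrow> w < L \<Longrightarrow> blank_from L (t(w := a))"
  by (auto simp: blank_from_def)

lemma layout_upd: "w < L \<Longrightarrow> (layout t L c)(w := a) = layout (t(w := a)) L c"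
  by (auto simp: layout_def fun_eq_iff)

text \<open>\<open>Ready\<close> grants permission only if \<open>E\<close> does, and
  \<open>Post\<close> moves exactly when \<open>E\<close> does. So the move of the environment and
  that of the machine reach both run tapes within the same step.\<close>

lemma ready_step:
  assumes sim: "sim m B C" and ready: "is_ready B" and step: "step machine e B D"
  shows "\<exists>m' C'. step E e' C C' \<and> sim m' D C'"
proof -
  from sim ready obtain s L c where al: "aligned B C" and h: "state B = to_nat (Ready (state C) s)"
    and *: "blank_from L (work C)" "s = min (S (val_head C)) M" "c = S (val_head C) - M"
      "work B = layout (work C) L c" "work_head B = work_head C" "work_head C < L"
    by (auto simp: sim_def is_ready_def)
  define a b r where abr: "a = work C (work_head C)" "b = valuation_tape e (val_head C)"
    "r = run_tape (pos C) (run_head C)"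
  have eqs: "val_head B = val_head C" "run_head B = run_head C" "pos B = pos C"
    "state C \<in> states E" "range (work C) \<subseteq> work_symbols E"
    using al by (auto simp: aligned_def)
  then have a: "a \<in> work_symbols E" by (auto simp: abr)
  have wB: "work B (work_head B) = a" using * by (simp add: layout_def abr)
  have b': "valuation_tape e' (val_head C) = G s b"
    using tape *(2) by (simp add: abr)
  obtain q' a' dw dv dr where d: "delta E (state C) a (G s b) r = (q', a', dw, dv, dr)"
    by (cases "delta E (state C) a (G s b) r") auto
  have closed: "q' \<in> states E" "a' \<in> work_symbols E"
    using delta_closed[OF epm eqs(4) a d] by auto
  define v where "v = move_head dv (val_head C)"
  have "\<exists>s' p. tr (Ready (state C) s) a b r = (Post q' s' p, a', dw, dv, dr) \<and> pend p s' c v"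
  proof (cases "dv = Lft")
    case True
    \<comment> \<open>A step to the left enters a comma exactly when it changes the entry. In cell 0
      the head stays where it is, and \<open>first\<close> excludes a comma there.\<close>
    have "S' v = S (val_head C)"
      using first True by (cases "val_head C") (auto simp: S'_def v_def)
    then show ?thesis
      using True a d *(2,3) by (auto intro!: exI[of _ s] exI[of _ Back])
  next
    case False
    consider "dv = Rgt \<and> b = CHR '','' \<and> s < M" | "dv = Rgt \<and> b = CHR '','' \<and> s = M"
      | "\<not> (dv = Rgt \<and> b = CHR '','')"
      using *(2) by fastforce
    then show ?thesis
    proof cases
      case 1
      then show ?thesis
        using a d *(2,3) by (auto intro!: exI[of _ "Suc s"] exI[of _ Idle] simp: v_def abr)
    next
      case 2
      then show ?thesis
        using a d *(2,3) by (auto intro!: exI[of _ s] exI[of _ Inc] simp: v_def abr)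
    next
      case 3
      have "S v = S (val_head C)"
        using 3 False by (cases dv) (auto simp: v_def abr)
      then show ?thesis
        using 3 False a d *(2,3) by (auto intro!: exI[of _ s] exI[of _ Idle])
    qed
  qed
  then obtain s' p where post: "tr (Ready (state C) s) a b r = (Post q' s' p, a', dw, dv, dr)" "pend p s' c v"
    by blast
  have s': "s' \<le> M" using pend_le post by blast
  let ?t = "(work C)(work_head C := a')"
  have t: "(work B)(work_head B := a') = layout ?t L c"
    using * by (simp add: layout_upd)
  have dB: "delta machine (state B) (work B (work_head B)) (valuation_tape e (val_head B))
      (run_tape (pos B) (run_head B)) = (to_nat (Post q' s' p), a', dw, dv, dr)"
    using post(1) by (simp add: machine_def h wB eqs del: tr.simps flip: abr)
  from step_det[OF step dB] obtain ms where ms: "ms = [] \<or> state B \<in> permission_states machine \<and> (\<exists>\<beta>. ms = [(Bot, \<beta>)])"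
    and D_B: "D = \<lparr>state = to_nat (Post q' s' p), work = (work B)(work_head B := a'),
      work_head = move_head dw (work_head B), val_head = move_head dv (val_head B),
      run_head = move_head dr (run_head B),
      pos = pos B @ ms @ (if to_nat (Post q' s' p) \<in> move_states machine
        then [(Top, work_move ((work B)(work_head B := a')))] else [])\<rparr>"
    by (elim exE conjE) (rule that)
  have D: "D = \<lparr>state = to_nat (Post q' s' p), work = layout ?t L c,
      work_head = move_head dw (work_head C), val_head = v, run_head = move_head dr (run_head C),
      pos = pos C @ ms @ (if to_nat (Post q' s' p) \<in> move_states machine
        then [(Top, work_move (layout ?t L c))] else [])\<rparr>"
    unfolding D_B t by (simp only: eqs(1-3) *(5) v_def)
  have mv: "to_nat (Post q' s' p) \<in> move_states machine \<longleftrightarrow> q' \<in> move_states E"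
    using closed s' by (auto simp: machine_def)
  have pm: "state B \<in> permission_states machine \<Longrightarrow> state C \<in> permission_states E"
    using h by (auto simp: machine_def)
  have blank: "blank_from L ?t" using * by (simp add: blank_from_upd)
  define C' where "C' = \<lparr>state = q', work = ?t,
      work_head = move_head dw (work_head C), val_head = v, run_head = move_head dr (run_head C),
      pos = pos C @ ms @ (if q' \<in> move_states E then [(Top, work_move ?t)] else [])\<rparr>"
  have "step E e' C C'"
    unfolding step_def C'_def using ms pm d by (auto simp: b' abr v_def)
  moreover have "sim (12, 0) D C'"
  proof -
    have "range ?t \<subseteq> work_symbols E" using eqs closed by auto
    moreover have "move_head dw (work_head C) \<le> L" using *(6) by (cases dw) auto
    ultimately show ?thesis
      unfolding sim_def
      by (intro conjI exI[of _ "Post q' s' p"] exI[of _ L] exI[of _ c])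
        (use closed blank post(2) in \<open>auto simp: aligned_def D C'_def mv work_move_layout\<close>)
  qed
  ultimately show ?thesis by blast
qed

lemma initial_segment_total:
  assumes "strict_mono (\<tau> :: nat \<Rightarrow> nat)"
  shows "\<exists>n. i \<le> \<tau> n"
  using assms strict_mono_imp_increasing by blast

lemma step_pos: "step E' e'' C D \<Longrightarrow> prefix (pos C) (pos D)"
  by (auto simp: step_def)

lemma branch_pos_mono:
  assumes "branch E' e'' B" "i \<le> j"
  shows "prefix (pos (B i)) (pos (B j))"
  using assms(2,1)
  by (induction j rule: dec_induct) (auto simp: branch_def intro: prefix_order.trans step_pos)

text \<open>Each branch on \<open>e\<close> yields a branch of \<open>E\<close> on \<open>e'\<close>
  that spells the same run, and the equal instances agree on its legality and its winner.\<close>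

lemma machine_wins_on:
  assumes "wins_on E A e'" "A e' = A' e"
  shows "wins_on machine A' e"
  unfolding wins_on_def
proof (intro allI impI)
  fix B \<Gamma>
  assume B: "branch machine e B" and sp: "spells B \<Gamma>" and leg: "\<not> illegal_by (Lr (A' e)) Bot \<Gamma>"
  have "wf busy_less" by (simp add: busy_less_def wf_lex_prod)
  then obtain f \<tau> where f: "f 0 = init_config E" "\<And>n. step E e' (f n) (f (Suc n))" "strict_mono \<tau>"
    and rel: "\<And>n. is_ready (B (\<tau> n)) \<and> (\<exists>m. sim m (B (\<tau> n)) (f n))"
    by (rule stuttering_simulation[where B = B and R = sim and stp = "step machine e" and stp' = "step E e'"
          and ready = is_ready and m = "(12, 0)" and c = "init_config E"])
      (use B sim_start busy_step ready_step in \<open>auto simp: branch_def\<close>)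
  have pos: "pos (f n) = pos (B (\<tau> n))" for n
    using rel[of n] by (auto simp: sim_def aligned_def)
  \<comment> \<open>Positions only grow and \<open>\<tau>\<close> is unbounded, so the sampled
    positions still exhaust the run.\<close>
  have "spells f \<Gamma>"
    unfolding spells_def
  proof (intro conjI allI)
    show "\<exists>k. pos (f n) = seq_take k \<Gamma>" for n
      using sp by (auto simp: spells_def pos)
    fix k
    obtain i where i: "prefix (seq_take k \<Gamma>) (pos (B i))"
      using sp by (auto simp: spells_def)
    obtain n where "i \<le> \<tau> n" using initial_segment_total[OF f(3)] by blast
    then have "prefix (pos (B i)) (pos (f n))" using branch_pos_mono[OF B] by (simp add: pos)
    then show "\<exists>n. prefix (seq_take k \<Gamma>) (pos (f n))"
      using i prefix_order.trans by blast
  qed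
  moreover have "branch E e' f" using f by (simp add: branch_def)
  ultimately have win: "fair E f" "Wn (A' e) \<Gamma> = Top"
    using assms leg by (auto simp: wins_on_def)
  \<comment> \<open>At the sampled times \<open>Ready\<close> carries the state of \<open>E\<close>,
    so permission carries over; injectivity of \<open>\<tau>\<close> keeps these times infinite in
    number.\<close>
  have "\<tau> n \<in> {n. state (B n) \<in> permission_states machine}"
    if "n \<in> {n. state (f n) \<in> permission_states E}" for n
  proof -
    have "\<exists>s \<le> M. state (B (\<tau> n)) = to_nat (Ready (state (f n)) s) \<and> state (f n) \<in> states E"
      using rel[of n] by (auto simp: sim_def is_ready_def aligned_def)
    then show ?thesis using that by (auto simp: machine_def)
  qed
  then have "\<tau> ` {n. state (f n) \<in> permission_states E} \<subseteq> {n. state (B n) \<in> permission_states machine}"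
    by blast
  moreover have "infinite (\<tau> ` {n. state (f n) \<in> permission_states E})"
    using win(1) f(3) by (simp add: fair_def finite_image_iff strict_mono_imp_inj_on inj_on_subset[OF _ subset_UNIV])
  ultimately show "fair machine B \<and> Wn (A' e) \<Gamma> = Top"
    using win(2) finite_subset by (auto simp: fair_def)
qed

end

section \<open>Merging interpretations\<close>

definition override :: "valuation \<Rightarrow> var list \<Rightarrow> cst list \<Rightarrow> valuation" where
  "override b xs cs x = (case map_of (zip xs cs) x of Some c \<Rightarrow> c | None \<Rightarrow> b x)"

lemma subst_game_override: "subst_game xs ts A e = A (override e xs (map (trm_val e) ts))"
  by (simp add: subst_game_def override_def[abs_def])

lemma override_nth:
  assumes "distinct xs" "length cs = length xs" "k < length xs"
  shows "override b xs cs (xs ! k) = cs ! k"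
  using assms by (simp add: override_def map_of_zip_nth)

lemma override_notin:
  assumes "length cs = length xs" "x \<notin> set xs"
  shows "override b xs cs x = b x"
  using assms by (simp add: override_def map_of_zip_is_None[THEN iffD2] split: option.split)

text \<open>\<open>depends_on\<close> compares valuations differing at one variable only, so
  \<open>e\<close> is turned into \<open>e'\<close> one variable at a time; hence the finiteness of
  \<open>Y\<close>.\<close>

lemma independent_eq:
  assumes "finite Y" "\<And>x. x \<in> Y \<Longrightarrow> \<not> depends_on A x" "\<And>x. x \<notin> Y \<Longrightarrow> e x = e' x"
  shows "A e = A e'"
  using assms
proof (induction Y arbitrary: e rule: finite_induct)
  case empty
  then have "e = e'" by auto
  then show ?case by simp
next
  case (insert y Y)
  have "differ_only_at y e (e(y := e' y))" by (simp add: differ_only_at_def)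
  then have "A e = A (e(y := e' y))"
    using insert.prems(1)[of y] unfolding depends_on_def by blast
  also have "\<dots> = A e'"
    using insert.prems by (intro insert.IH) auto
  finally show ?case .
qed

text \<open>Tags exceed \<open>K\<close>, so they miss the variables of a formula whose variables
  lie below \<open>K\<close>.\<close>

definition tag :: "nat \<Rightarrow> nat \<Rightarrow> var" where
  "tag K j = Suc (2 * (K + j))"

text \<open>Decodes the index from the tag values. If no tag value starts with 2, the result is
  unspecified but still a function of the tag values.\<close>

definition idx :: "nat \<Rightarrow> valuation \<Rightarrow> nat" where
  "idx K e = (LEAST j. hd (const_name (e (tag K j))) = CHR ''2'')"

text \<open>All tags are odd, so these canonical tuples do not interfere with the index.\<close>

definition canon :: "nat \<Rightarrow> var list" where
  "canon n = map (\<lambda>k. 2 * k) [0..<n]"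

text \<open>The index selects an interpretation, whose canonical variables receive the arguments
  while all its other variables are frozen at \<open>b\<close>. Hence only the tags and the
  canonical tuple matter.\<close>

definition merged :: "nat \<Rightarrow> (nat \<Rightarrow> interp) \<Rightarrow> (nat \<Rightarrow> valuation) \<Rightarrow> interp" where
  "merged K I b L = (canon (arity L), \<lambda>e.
     snd (I (idx K e) L) (override (b (idx K e)) (fst (I (idx K e) L)) (map e (canon (arity L)))))"

lemma length_canon [simp]: "length (canon n) = n"
  by (simp add: canon_def)

lemma distinct_canon: "distinct (canon n)"
  by (simp add: canon_def distinct_map inj_on_def)

lemma tag_notin_canon: "tag K j \<notin> set (canon n)"
  by (auto simp: canon_def tag_def) presburger

lemma idx_cong: "(\<And>j. e (tag K j) = e' (tag K j)) \<Longrightarrow> idx K e = idx K e'"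
  by (simp add: idx_def)

lemma idx_upd: "x < K \<Longrightarrow> idx K (e(x := c)) = idx K e"
  by (intro idx_cong) (auto simp: tag_def)

text \<open>Every instance of a merged game is an instance of the game of some \<open>I i\<close>,
  and the conditions on games are conditions on single instances.\<close>

lemma interpretation_merged:
  assumes I: "\<And>i. interpretation_of_letters (I i)"
  shows "interpretation_of_letters (merged K I b)"
proof -
  have "is_game (snd (I i L))" "elementary (snd (I i (Elem n k)))" "static (snd (I i (Gen n k)))" for i L n k
    using I[of i] by (auto simp: interpretation_of_letters_def)
  note ptwise = this(1)[unfolded is_game_def, rule_format] this(2)[unfolded elementary_def, rule_format]
    this(3)[unfolded static_def, rule_format]
  have "is_game (snd (merged K I b L))" for L
    using ptwise(1) by (simp add: is_game_def merged_def)
  moreover have "elementary (snd (merged K I b (Elem n k)))" for n k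
    using ptwise(2) by (simp add: elementary_def merged_def)
  moreover have "static (snd (merged K I b (Gen n k)))" for n k
    unfolding static_def merged_def snd_conv by (intro allI impI) (rule ptwise(3))
  moreover have "length (fst (merged K I b L)) = arity L" "distinct (fst (merged K I b L))" for L
    by (simp_all add: merged_def distinct_canon)
  ultimately show ?thesis
    unfolding interpretation_of_letters_def by blast
qed

lemma blind_args_arity: "well_formed F \<Longrightarrow> (L, k) \<in> blind_args X F \<Longrightarrow> k < arity L"
  by (induction F arbitrary: X) auto

lemma admissible_merged:
  assumes F: "well_formed F" "vars_of F \<subseteq> {..<K}"
    and I: "\<And>i. interpretation_of_letters (I i)" "\<And>i. admissible F (I i)"
  shows "admissible F (merged K I b)"
  unfolding admissible_def
proof (intro conjI ballI impI, goal_cases)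
  case (1 L x)
  then have x: "x < K" "x \<notin> set (canon (arity L))" using F by (auto simp: merged_def)
  have "snd (merged K I b L) e = snd (merged K I b L) e'" if d: "differ_only_at x e e'" for e e'
  proof -
    have "idx K e = idx K e'"
      using d x by (intro idx_cong) (auto simp: differ_only_at_def tag_def)
    moreover have "map e (canon (arity L)) = map e' (canon (arity L))"
      using d x by (auto simp: differ_only_at_def)
    ultimately show ?thesis by (simp only: merged_def snd_conv)
  qed
  then show ?case by (auto simp: depends_on_def)
next
  case (2 Lk)
  obtain L k where Lk: "Lk = (L, k)" by (cases Lk)
  have k: "k < arity L" using blind_args_arity F 2 Lk by blast
  have "Lr (snd (merged K I b L) e) = Lr (snd (merged K I b L) e')"
    if d: "differ_only_at (canon (arity L) ! k) e e'" for e e'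
  proof -
    \<comment> \<open>Changing the \<open>k\<close>-th canonical variable leaves the tags alone, so
      it only changes the \<open>k\<close>-th canonical variable of one fixed \<open>I i\<close>,
      where unistructurality is known.\<close>
    have idx: "idx K e = idx K e'"
      using d k tag_notin_canon by (intro idx_cong) (metis differ_only_at_def length_canon nth_mem)
    let ?i = "idx K e'" and ?xs = "fst (I (idx K e') L)"
    have xs: "length ?xs = arity L" "distinct ?xs"
      using I by (auto simp: interpretation_of_letters_def)
    have "differ_only_at (?xs ! k) (override (b ?i) ?xs (map e (canon (arity L))))
       (override (b ?i) ?xs (map e' (canon (arity L))))"
      unfolding differ_only_at_def
    proof (intro allI impI)
      fix y
      assume y: "y \<noteq> ?xs ! k"
      show "override (b ?i) ?xs (map e (canon (arity L))) y =
        override (b ?i) ?xs (map e' (canon (arity L))) y"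
      proof (cases "y \<in> set ?xs")
        case True
        then obtain l where l: "y = ?xs ! l" "l < arity L" by (metis in_set_conv_nth xs(1))
        then have "l \<noteq> k" using y by auto
        then have "canon (arity L) ! l \<noteq> canon (arity L) ! k"
          using l k by (simp add: distinct_canon nth_eq_iff_index_eq)
        then have "e (canon (arity L) ! l) = e' (canon (arity L) ! l)"
          using d by (auto simp: differ_only_at_def)
        then show ?thesis using l xs by (simp add: override_nth)
      qed (simp add: override_notin xs)
    qed
    moreover have "unistructural_in (snd (I ?i L)) (?xs ! k)"
      using I(2)[of ?i] 2 Lk by (auto simp: admissible_def)
    ultimately show ?thesis
      by (simp add: merged_def idx unistructural_in_def)
  qed
  then show ?case by (auto simp: Lk unistructural_in_def merged_def)
qed

text \<open>\<open>Ls\<close> and \<open>X\<close> stay fixed while the induction descends into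
  subformulas. A quantifier updates \<open>e\<close> and \<open>e'\<close> alike at a variable in
  \<open>X\<close>, which lies below \<open>K\<close> and so leaves the index unchanged.\<close>

lemma game_of_merged:
  assumes F: "well_formed F" "letters_of F \<subseteq> Ls" "free_vars F \<union> bound_vars F \<subseteq> X"
    and X: "X \<subseteq> {..<K}"
    and I: "interpretation_of_letters (I i)"
    and indep: "\<And>L x. L \<in> Ls \<Longrightarrow> x \<in> X \<Longrightarrow> x \<notin> set (fst (I i L)) \<Longrightarrow> \<not> depends_on (snd (I i L)) x"
    and e: "idx K e = i" "\<And>x. x \<in> X \<Longrightarrow> e x = e' x" "\<And>x. x \<notin> X \<Longrightarrow> e' x = b i x"
  shows "game_of (merged K I b) F e = game_of (I i) F e'"
proof -
  have upd: "idx K (e(x := c)) = i" if "x \<in> X" "idx K e = i" for e x c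
    using that idx_upd[of x K e c] X by auto
  show ?thesis
    using F e
  proof (induction F arbitrary: e e')
    case (Atom L ts)
    let ?xs = "fst (I i L)" and ?cs = "map (trm_val e) ts" and ?ys = "canon (arity L)"
    have len: "length ts = arity L" "length ?xs = arity L" "distinct ?xs"
      using Atom I by (auto simp: interpretation_of_letters_def)
    have cs: "map (trm_val e') ts = ?cs"
    proof (rule map_cong[OF refl])
      fix t
      assume "t \<in> set ts"
      then have "x \<in> X" if "t = TVar x" for x using Atom(3) that by auto
      then show "trm_val e' t = trm_val e t" using Atom(5) by (cases t) auto
    qed
    \<comment> \<open>The valuation at which the atom evaluates the merged game: the arguments go
      into even variables, so the index survives.\<close>
    define d where "d = override e ?ys ?cs"
    have "d (tag K j) = e (tag K j)" for j
      unfolding d_def using len tag_notin_canon by (intro override_notin) auto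
    then have "idx K d = i"
      using idx_cong[of d K e] Atom(4) by simp
    moreover have "map d ?ys = ?cs"
      using len unfolding d_def by (intro nth_equalityI) (simp_all add: override_nth distinct_canon)
    ultimately have "game_of (merged K I b) (Atom L ts) e = snd (I i L) (override (b i) ?xs ?cs)"
      by (simp add: subst_game_override merged_def d_def)
    \<comment> \<open>\<open>b i\<close> and \<open>e'\<close> agree outside \<open>X\<close>, and
      the arguments override both on \<open>?xs\<close>. On the remaining variables
      \<open>indep\<close> applies.\<close>
    also have "\<dots> = snd (I i L) (override e' ?xs ?cs)"
    proof (rule independent_eq)
      show "finite (X - set ?xs)" using X finite_subset by blast
      show "\<not> depends_on (snd (I i L)) x" if "x \<in> X - set ?xs" for x
        using that indep Atom by auto
      show "override (b i) ?xs ?cs x = override e' ?xs ?cs x" if "x \<notin> X - set ?xs" for x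
      proof (cases "x \<in> set ?xs")
        case True
        then obtain k where "x = ?xs ! k" "k < arity L" by (metis in_set_conv_nth len(2))
        then show ?thesis using len by (simp add: override_nth)
      next
        case False
        then show ?thesis using that len Atom by (simp add: override_notin)
      qed
    qed
    finally show ?case by (simp add: subst_game_override cs)
  next
    case (BAll x F)
    have "game_of (merged K I b) F (e(x := c)) = game_of (I i) F (e'(x := c))" for c
      by (rule BAll.IH[OF _ _ _ upd]) (use BAll.prems in auto)
    \<comment> \<open>\<open>blind_quant\<close> takes its legal runs from the instance at
      \<open>e\<close> itself.\<close>
    moreover have "game_of (merged K I b) F e = game_of (I i) F e'"
      using BAll by (intro BAll.IH) auto
    ultimately show ?case by (simp add: blind_quant_def)
  next
    case (BEx x F)
    have "game_of (merged K I b) F (e(x := c)) = game_of (I i) F (e'(x := c))" for c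
      by (rule BEx.IH[OF _ _ _ upd]) (use BEx.prems in auto)
    moreover have "game_of (merged K I b) F e = game_of (I i) F e'"
      using BEx by (intro BEx.IH) auto
    ultimately show ?case by (simp add: blind_quant_def)
  next
    case (CAll x F)
    have "game_of (merged K I b) F (e(x := c)) = game_of (I i) F (e'(x := c))" for c
      by (rule CAll.IH[OF _ _ _ upd]) (use CAll.prems in auto)
    then show ?case by (simp add: choice_quant_def)
  next
    case (CEx x F)
    have "game_of (merged K I b) F (e(x := c)) = game_of (I i) F (e'(x := c))" for c
      by (rule CEx.IH[OF _ _ _ upd]) (use CEx.prems in auto)
    then show ?case by (simp add: choice_quant_def)
  next
    case (PAnd Fs)
    have "map (\<lambda>F. game_of (merged K I b) F e) Fs = map (\<lambda>F. game_of (I i) F e') Fs"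
      using PAnd by (intro map_cong[OF refl] PAnd.IH) auto
    then show ?case by (simp only: game_of.simps)
  next
    case (POr Fs)
    have "map (\<lambda>F. game_of (merged K I b) F e) Fs = map (\<lambda>F. game_of (I i) F e') Fs"
      using POr by (intro map_cong[OF refl] POr.IH) auto
    then show ?case by (simp only: game_of.simps)
  next
    case (CAnd Fs)
    have "map (\<lambda>F. game_of (merged K I b) F e) Fs = map (\<lambda>F. game_of (I i) F e') Fs"
      using CAnd by (intro map_cong[OF refl] CAnd.IH) auto
    then show ?case by (simp only: game_of.simps)
  next
    case (COr Fs)
    have "map (\<lambda>F. game_of (merged K I b) F e) Fs = map (\<lambda>F. game_of (I i) F e') Fs"
      using COr by (intro map_cong[OF refl] COr.IH) auto
    then show ?case by (simp only: game_of.simps)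
  next
    case (Neg F)
    have "game_of (merged K I b) F e = game_of (I i) F e'"
      using Neg by (intro Neg.IH) auto
    then show ?case by simp
  next
    case (Imp F G)
    have "game_of (merged K I b) F e = game_of (I i) F e'" "game_of (merged K I b) G e = game_of (I i) G e'"
      using Imp by (intro Imp.IH; auto)+
    then show ?case by simp
  qed simp_all
qed

lemma finite_vars_of: "finite (free_vars F \<union> bound_vars F)"
proof (induction F)
  case (Atom L ts)
  have "{x. TVar x \<in> set ts} \<subseteq> (\<lambda>t. case t of TVar x \<Rightarrow> x | TConst c \<Rightarrow> 0) ` set ts"
    by (force simp: image_iff split: trm.split)
  then show ?case by (simp add: finite_subset)
qed auto

section \<open>The diagonal argument\<close>

lemma ex_recolouring_epm:
  assumes E: "is_epm E" and D: "ran D \<subseteq> {CHR ''1'', CHR ''2''}" "\<And>s. M \<le> s \<Longrightarrow> D s = None"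
  obtains E' where "is_epm E'"
    "\<And>A A' e. wins_on E A (recolour D e) \<Longrightarrow> A (recolour D e) = A' e \<Longrightarrow> wins_on E' A' e"
proof -
  have "finite (Aux -` work_symbols E)"
    using E by (intro finite_vimageI) (auto simp: is_epm_def inj_def)
  then obtain N where N: "\<And>n. Aux n \<in> work_symbols E \<Longrightarrow> n < N"
    by (auto simp: finite_nat_iff_bounded)
  \<comment> \<open>\<open>Suc M\<close> is a positive cap, and from there on \<open>D\<close> is
    undefined, so capping the index does not affect the painting.\<close>
  interpret recolouring E "Suc M" "paint D" "Aux N" "Aux (Suc N)" "Aux (Suc (Suc N))"
    using E N[of N] N[of "Suc N"] N[of "Suc (Suc N)"] by unfold_locales auto
  show thesis
  proof (rule that[OF is_epm_machine])
    fix A A' e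
    assume w: "wins_on E A (recolour D e)" "A (recolour D e) = A' e"
    interpret recoloured_valuation E "Suc M" "paint D" "Aux N" "Aux (Suc N)" "Aux (Suc (Suc N))"
      e "recolour D e"
    proof
      fix v
      have "paint D (min s (Suc M)) c = paint D s c" for s c
        using D(2) by (simp add: min_def paint_def)
      then show "valuation_tape (recolour D e) v =
          paint D (min (seg (valuation_tape e) v) (Suc M)) (valuation_tape e v)"
        by (simp add: valuation_tape_recolour[OF D(1)])
    qed (rule valuation_tape_0)
    show "wins_on machine A' e" by (rule machine_wins_on[where A = A and A' = A']) (rule w)+
  qed
qed

definition colours :: "nat \<Rightarrow> nat \<Rightarrow> var \<Rightarrow> char option" where
  "colours K i x =
     (if x \<in> tag K ` {..<i} then Some (CHR ''1'')
      else if x = tag K i then Some (CHR ''2'') else None)"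

text \<open>Names are nonempty, so the leading digit shows the colour: 1 at every tag before the
  \<open>i\<close>-th, and 2 at that tag.\<close>

lemma idx_recolour: "idx K (recolour (colours K i) e) = i"
proof -
  have tag: "tag K j = tag K k \<longleftrightarrow> j = k" for j k
    by (auto simp: tag_def)
  have name: "const_name (recolour (colours K i) e (tag K j)) =
      replicate (length (const_name (e (tag K j)))) (if j < i then CHR ''1'' else CHR ''2'')" if "j \<le> i" for j
    using that const_name_nonempty
    by (auto simp: recolour_def colours_def tag image_iff const_name_repdigit)
  have hd: "hd (const_name (recolour (colours K i) e (tag K j))) = (if j < i then CHR ''1'' else CHR ''2'')"
    if "j \<le> i" for j
    using name[OF that] const_name_nonempty by (simp add: hd_replicate)
  show ?thesis
    unfolding idx_def
  proof (rule Least_equality)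
    show "hd (const_name (recolour (colours K i) e (tag K i))) = CHR ''2''"
      using hd[of i] by simp
    fix j
    assume "hd (const_name (recolour (colours K i) e (tag K j))) = CHR ''2''"
    then show "i \<le> j" using hd[of j] by (cases "j < i") auto
  qed
qed

lemma ex_epm: "\<exists>E. is_epm E"
proof -
  have "is_epm \<lparr>states = {0}, work_symbols = insert Blank (range Chr), start_state = 0, move_states = {},
      permission_states = {}, delta = \<lambda>q a b r. (q, a, Stay, Stay, Stay)\<rparr>"
    by (simp add: is_epm_def)
  then show ?thesis by blast
qed

lemma valid_imp_uniformly_valid:
  assumes F: "well_formed F" and valid: "valid F"
  shows "uniformly_valid F"
proof (rule ccontr)
  assume "\<not> uniformly_valid F"
  then have no: "\<exists>I e. interpretation_of_letters I \<and> admissible F I \<and> \<not> wins_on E (game_of I F) e"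
    if "is_epm E" for E
    using that by (auto simp: uniformly_valid_def wins_def)
  obtain K where K: "vars_of F \<subseteq> {..<K}"
    using finite_vars_of[of F] by (auto simp: vars_of_def finite_nat_iff_bounded)
  let ?codes = "code ` Collect is_epm"
  \<comment> \<open>The claim covers every \<open>A\<close> with the right instance because the
    merged game is available only after all \<open>I i\<close> and \<open>b i\<close> have been
    chosen.\<close>
  have "\<exists>I b. interpretation_of_letters I \<and> admissible F I \<and>
      (\<forall>E A. is_epm E \<longrightarrow> code E = from_nat_into ?codes i \<longrightarrow>
        A (recolour (colours K i) b) = game_of I F b \<longrightarrow> \<not> wins_on E A (recolour (colours K i) b))" for i
  proof -
    have "from_nat_into ?codes i \<in> ?codes"
      using ex_epm by (intro from_nat_into) auto
    then obtain E where E: "is_epm E" "from_nat_into ?codes i = code E" by auto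
    have D: "ran (colours K i) \<subseteq> {CHR ''1'', CHR ''2''}"
      by (auto simp: ran_def colours_def split: if_splits)
    have none: "colours K i s = None" if "Suc (tag K i) \<le> s" for s
      using that by (auto simp: colours_def tag_def)
    obtain E' where E': "is_epm E'" "\<And>A A' e. wins_on E A (recolour (colours K i) e) \<Longrightarrow>
        A (recolour (colours K i) e) = A' e \<Longrightarrow> wins_on E' A' e"
      using ex_recolouring_epm[OF E(1) D none] by blast
    obtain I b where I: "interpretation_of_letters I" "admissible F I" "\<not> wins_on E' (game_of I F) b"
      using no[OF E'(1)] by blast
    have "\<not> wins_on E2 A (recolour (colours K i) b)"
      if "is_epm E2" "code E2 = from_nat_into ?codes i" "A (recolour (colours K i) b) = game_of I F b" for E2 A
    proof
      assume "wins_on E2 A (recolour (colours K i) b)"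
      then have "wins_on E A (recolour (colours K i) b)"
        by (rule wins_on_code[OF that(1) that(2)[unfolded E(2)]])
      then have "wins_on E' (game_of I F) b"
        using that(3) by (rule E'(2))
      then show False using I(3) by contradiction
    qed
    then show ?thesis using I by blast
  qed
  then obtain I b where I: "\<And>i. interpretation_of_letters (I i)" "\<And>i. admissible F (I i)"
    and lose: "\<And>i E A. is_epm E \<Longrightarrow> code E = from_nat_into ?codes i \<Longrightarrow>
      A (recolour (colours K i) (b i)) = game_of (I i) F (b i) \<Longrightarrow>
      \<not> wins_on E A (recolour (colours K i) (b i))"
    by metis
  let ?A = "game_of (merged K I b) F"
  have "winnable ?A"
    using valid[unfolded valid_def, rule_format, OF interpretation_merged[OF I(1)] admissible_merged[OF F K I]] .
  then obtain E where E: "is_epm E" "wins E ?A"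
    by (auto simp: winnable_def)
  \<comment> \<open>The diagonal index: the assumed winner \<open>E\<close> is met at the valuation
    prepared against its own code.\<close>
  define i where "i = to_nat_on ?codes (code E)"
  have code: "code E = from_nat_into ?codes i"
    using E countable_codes by (simp add: i_def)
  have "?A (recolour (colours K i) (b i)) = game_of (I i) F (b i)"
  proof (rule game_of_merged[where Ls = "letters_of F" and X = "vars_of F"])
    show "\<not> depends_on (snd (I i L)) x" if "L \<in> letters_of F" "x \<in> vars_of F" "x \<notin> set (fst (I i L))" for L x
      using I(2)[of i] that by (auto simp: admissible_def)
    show "recolour (colours K i) (b i) x = b i x" if "x \<in> vars_of F" for x
      using that K by (auto simp: recolour_def colours_def tag_def)
  qed (use F K I idx_recolour in \<open>auto simp: vars_of_def\<close>)
  then show False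
    using lose[OF E(1) code] E(2) by (auto simp: wins_def)
qed

theorem theorem9p5:
  fixes F :: formula
  assumes "cl4_formula F"
  shows "valid F \<longleftrightarrow> uniformly_valid F"
proof
  assume "valid F"
  then show "uniformly_valid F"
    using assms valid_imp_uniformly_valid by (simp add: cl4_formula_def)
next
  assume "uniformly_valid F"
  then show "valid F"
    unfolding valid_def uniformly_valid_def winnable_def by blast
qed

end
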